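(* Let $n\ge1$ and let $R$ be a unital full subring of the polydisk algebra $A(\mathbb D^n)$, let $S:=C(\mathbb T^n)\times C(\mathbb T)$ with the involution $(f,g)^*=(\overline f,\overline g)$ (pointwise complex conjugation), let $G:=\mathbb Z$, and let $\iota:\mathrm{inv}\,S\to\mathbb Z$ be $\iota(g,h)=\mathtt w(h)$, the winding number of $h$. Regard $R$ as a subring of $S$ through the injective ring homomorphism $f\mapsto(f|_{\mathbb T^n},f_d)$, where $f_d(z)=f(z,\dots,z)$. Then the following hold: (A1) $R$ is a commutative integral domain with identity. (A2) $S$ is a unital commutative complex semisimple Banach algebra with involution $\cdot^*$, and $R\subset S$. (A3) (I1) $\iota(ab)=\iota(a)+\iota(b)$ for all $a,b\in\mathrm{inv}\,S$; (I2) $\iota(a^* )=-\iota(a)$ for all $a\in\mathrm{inv}\,S$; (I3) $\iota$ is locally constant, i.e. continuous when $G$ is given the discrete topology. (A4) An element $x\in R\cap\mathrm{inv}\,S$ is invertible as an element of $R$ if and only if $\iota(x)=0$.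
   Context: $\mathbb D^n=\{z\in\mathbb C^n:|z_i|<1\ \forall i\}$, $\overline{\mathbb D^n}=\{z\in\mathbb C^n:|z_i|\le1\ \forall i\}$, $\mathbb T^n=\{z\in\mathbb C^n:|z_i|=1\ \forall i\}$, $\mathbb T=\mathbb T^1$. $A(\mathbb D^n)$ is the set of functions $\overline{\mathbb D^n}\to\mathbb C$ continuous on $\overline{\mathbb D^n}$ and holomorphic in $\mathbb D^n$. $C(\mathbb T^n)$, $C(\mathbb T)$ are algebras of continuous complex functions with sup norms; the product $S$ has componentwise operations and the maximum norm. $\mathrm{inv}\,S$ is the set of invertible elements of $S$. For $h\in\mathrm{inv}\,C(\mathbb T)$, $\mathtt w(h)=\frac1{2\pi}(\Theta(2\pi)-\Theta(0))$, where $\Theta:[0,2\pi]\to\mathbb R$ is continuous with $h(e^{it})=|h(e^{it})|e^{i\Theta(t)}$. A subring $R_1$ of a commutative unital ring $R_2$ is full if every $x\in R_1$ that is invertible in $R_2$ is invertible in $R_1$. *)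

theory Defs
  imports "HOL-Analysis.Analysis" "HOL-Algebra.Algebra" "HOL-Algebra.Algebraic_Closure_Type"
begin

section \<open>Polydisk, torus and circle\<close>

text \<open>The dimension \<open>n\<close> is \<open>CARD('n)\<close> for the finite (hence nonempty) index type \<open>'n\<close>.\<close>

definition open_polydisk :: "(complex ^ 'n) set" where
  "open_polydisk = {z. \<forall>i. cmod (z $ i) < 1}"

definition closed_polydisk :: "(complex ^ 'n) set" where
  "closed_polydisk = {z. \<forall>i. cmod (z $ i) \<le> 1}"

definition torus :: "(complex ^ 'n) set" where
  "torus = {z. \<forall>i. cmod (z $ i) = 1}"

definition circle :: "complex set" where
  "circle = {z. cmod z = 1}"

section \<open>Algebras of functions\<close>

text \<open>A function on \<open>K\<close> is represented by the function on the whole type that agrees with it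
  on \<open>K\<close> and is \<open>undefined\<close> elsewhere, so that equality on the carrier is equality on \<open>K\<close>.\<close>

definition function_algebra ::
    "'a set \<Rightarrow> ('a \<Rightarrow> complex) set \<Rightarrow> (complex, 'a \<Rightarrow> complex) module" where
  "function_algebra K F =
     \<lparr> carrier = F \<inter> extensional K,
       monoid.mult = (\<lambda>f g. \<lambda>z\<in>K. f z * g z),
       one = (\<lambda>z\<in>K. 1),
       ring.zero = (\<lambda>z\<in>K. 0),
       add = (\<lambda>f g. \<lambda>z\<in>K. f z + g z),
       smult = (\<lambda>c f. \<lambda>z\<in>K. c * f z) \<rparr>"

definition cont_algebra ::
    "'a::topological_space set \<Rightarrow> (complex, 'a \<Rightarrow> complex) module" where
  "cont_algebra K = function_algebra K {f. continuous_on K f}"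

definition sup_norm :: "'a set \<Rightarrow> ('a \<Rightarrow> complex) \<Rightarrow> real" where
  "sup_norm K f = (SUP z\<in>K. cmod (f z))"

text \<open>Holomorphy in several variables on an open set: at every point the Frechet derivative exists
  and is complex linear (a real linear derivative being part of \<open>has_derivative\<close>).\<close>

definition holomorphic_several_on :: "(complex ^ 'n \<Rightarrow> complex) \<Rightarrow> (complex ^ 'n) set \<Rightarrow> bool" where
  "holomorphic_several_on f U \<longleftrightarrow>
     (\<forall>z\<in>U. \<exists>f'. (f has_derivative f') (at z) \<and> (\<forall>c v. f' (c *s v) = c * f' v))"

definition polydisk_algebra :: "(complex, complex ^ 'n \<Rightarrow> complex) module" where
  "polydisk_algebra = function_algebra closed_polydisk
     {f. continuous_on closed_polydisk f \<and> holomorphic_several_on f open_polydisk}"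

section \<open>Full subrings\<close>

definition full_subring :: "'a set \<Rightarrow> ('a, 'm) ring_scheme \<Rightarrow> bool" where
  "full_subring H A \<longleftrightarrow> subring H A \<and> (\<forall>x\<in>H. x \<in> Units A \<longrightarrow> x \<in> Units (A\<lparr>carrier := H\<rparr>))"

section \<open>Commutative Banach algebras\<close>

text \<open>Distances to points outside the carrier are set to \<open>0\<close> because the locale
  \<^term>\<open>Metric_space\<close> requires nonnegativity and symmetry on the whole type.\<close>

definition norm_dist :: "('a, 'm) ring_scheme \<Rightarrow> ('a \<Rightarrow> real) \<Rightarrow> 'a \<Rightarrow> 'a \<Rightarrow> real" where
  "norm_dist A N x y = (if x \<in> carrier A \<and> y \<in> carrier A then N (x \<ominus>\<^bsub>A\<^esub> y) else 0)"

definition norm_topology :: "('a, 'm) ring_scheme \<Rightarrow> ('a \<Rightarrow> real) \<Rightarrow> 'a topology" where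
  "norm_topology A N = Metric_space.mtopology (carrier A) (norm_dist A N)"

text \<open>The locale \<^term>\<open>algebra\<close> already demands that \<open>A\<close> is commutative with identity.\<close>

locale complex_comm_banach_algebra =
  algebra "ring_of_type_algebra :: complex ring" A
    for A :: "(complex, 'a) module" (structure) and N :: "'a \<Rightarrow> real" +
  assumes norm_nonneg: "x \<in> carrier A \<Longrightarrow> 0 \<le> N x"
    and norm_eq_zero: "x \<in> carrier A \<Longrightarrow> N x = 0 \<longleftrightarrow> x = \<zero>\<^bsub>A\<^esub>"
    and norm_triangle: "x \<in> carrier A \<Longrightarrow> y \<in> carrier A \<Longrightarrow> N (x \<oplus>\<^bsub>A\<^esub> y) \<le> N x + N y"
    and norm_smult: "x \<in> carrier A \<Longrightarrow> N (c \<odot>\<^bsub>A\<^esub> x) = cmod c * N x"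
    and norm_mult: "x \<in> carrier A \<Longrightarrow> y \<in> carrier A \<Longrightarrow> N (x \<otimes>\<^bsub>A\<^esub> y) \<le> N x * N y"
    and norm_one: "N \<one>\<^bsub>A\<^esub> = 1"
    and complete: "Metric_space.mcomplete (carrier A) (norm_dist A N)"

text \<open>Semisimplicity of a commutative algebra with identity: its Jacobson radical, the
  intersection of its maximal ideals, vanishes. (With an identity, ring ideals are
  closed under scalar multiplication.)\<close>

definition comm_semisimple :: "('a, 'm) ring_scheme \<Rightarrow> bool" where
  "comm_semisimple A \<longleftrightarrow> \<Inter>{I. maximalideal I A} = {\<zero>\<^bsub>A\<^esub>}"

definition algebra_involution :: "(complex, 'a) module \<Rightarrow> ('a \<Rightarrow> 'a) \<Rightarrow> bool" where
  "algebra_involution A star \<longleftrightarrow>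
     (\<forall>x\<in>carrier A. star x \<in> carrier A \<and> star (star x) = x) \<and>
     (\<forall>x\<in>carrier A. \<forall>y\<in>carrier A. star (x \<oplus>\<^bsub>A\<^esub> y) = star x \<oplus>\<^bsub>A\<^esub> star y) \<and>
     (\<forall>c. \<forall>x\<in>carrier A. star (c \<odot>\<^bsub>A\<^esub> x) = cnj c \<odot>\<^bsub>A\<^esub> star x) \<and>
     (\<forall>x\<in>carrier A. \<forall>y\<in>carrier A. star (x \<otimes>\<^bsub>A\<^esub> y) = star y \<otimes>\<^bsub>A\<^esub> star x)"

section \<open>The algebra \<open>C(T\<^sup>n) \<times> C(T)\<close>\<close>

definition product_algebra ::
    "('k, 'a) module \<Rightarrow> ('k, 'b) module \<Rightarrow> ('k, 'a \<times> 'b) module" where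
  "product_algebra A B =
     \<lparr> carrier = carrier A \<times> carrier B,
       monoid.mult = (\<lambda>(a, b) (a', b'). (a \<otimes>\<^bsub>A\<^esub> a', b \<otimes>\<^bsub>B\<^esub> b')),
       one = (\<one>\<^bsub>A\<^esub>, \<one>\<^bsub>B\<^esub>),
       ring.zero = (\<zero>\<^bsub>A\<^esub>, \<zero>\<^bsub>B\<^esub>),
       add = (\<lambda>(a, b) (a', b'). (a \<oplus>\<^bsub>A\<^esub> a', b \<oplus>\<^bsub>B\<^esub> b')),
       smult = (\<lambda>c (a, b). (c \<odot>\<^bsub>A\<^esub> a, c \<odot>\<^bsub>B\<^esub> b)) \<rparr>"

definition S_algebra ::
    "(complex, (complex ^ 'n \<Rightarrow> complex) \<times> (complex \<Rightarrow> complex)) module" where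
  "S_algebra = product_algebra (cont_algebra torus) (cont_algebra circle)"

definition S_norm :: "(complex ^ 'n \<Rightarrow> complex) \<times> (complex \<Rightarrow> complex) \<Rightarrow> real" where
  "S_norm = (\<lambda>(f, g). max (sup_norm torus f) (sup_norm circle g))"

definition S_star :: "(complex ^ 'n \<Rightarrow> complex) \<times> (complex \<Rightarrow> complex)
    \<Rightarrow> (complex ^ 'n \<Rightarrow> complex) \<times> (complex \<Rightarrow> complex)" where
  "S_star = (\<lambda>(f, g). (\<lambda>z\<in>torus. cnj (f z), \<lambda>z\<in>circle. cnj (g z)))"

text \<open>For continuous zero-free \<open>h\<close> a continuous argument \<open>\<Theta>\<close> exists, and the quotient below is an
  integer independent of the choice of \<open>\<Theta>\<close>; for other \<open>h\<close> the value is irrelevant.\<close>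

definition wind :: "(complex \<Rightarrow> complex) \<Rightarrow> int" where
  "wind h = (THE k. \<exists>\<Theta> :: real \<Rightarrow> real. continuous_on {0..2 * pi} \<Theta> \<and>
     (\<forall>t\<in>{0..2 * pi}. h (exp (\<i> * of_real t)) =
        of_real (cmod (h (exp (\<i> * of_real t)))) * exp (\<i> * of_real (\<Theta> t))) \<and>
     real_of_int k = 1 / (2 * pi) * (\<Theta> (2 * pi) - \<Theta> 0))"

definition iota :: "(complex ^ 'n \<Rightarrow> complex) \<times> (complex \<Rightarrow> complex) \<Rightarrow> int" where
  "iota = (\<lambda>(g, h). wind h)"

definition embed_S :: "(complex ^ 'n \<Rightarrow> complex)
    \<Rightarrow> (complex ^ 'n \<Rightarrow> complex) \<times> (complex \<Rightarrow> complex)" where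
  "embed_S f = (\<lambda>z\<in>torus. f z, \<lambda>z\<in>circle. f (\<chi> i. z))"

end

theory Submission
  imports Defs "HOL-Complex_Analysis.Complex_Analysis"
begin

text \<open>The heart of the matter is (A4). For \<open>a\<close> in the open polydisk, the curve
  \<open>z \<mapsto> ((z + a\<^sub>i) / (1 + cnj a\<^sub>i z))\<^sub>i\<close> maps the disc into the polydisk, the circle into the torus
  and \<open>0\<close> to \<open>a\<close>; shrinking \<open>a\<close> to \<open>0\<close> deforms it into the diagonal within these constraints.
  Hence, if \<open>f\<close> has no zeros on the torus, the restriction of \<open>f\<close> to this curve has the
  winding number of \<open>f\<^sub>d\<close>. If that vanishes, the restriction has no zeros in the disc, and the maximum principle for
  its inverse bounds \<open>\<bar>f a\<bar>\<close> from below by the minimum of \<open>\<bar>f\<bar>\<close> on the torus. So \<open>1 / f\<close> lies in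
  the polydisk algebra, and fullness applies. The same curves show that the maximum modulus is
  attained on the torus, which gives injectivity of the embedding.\<close>

section \<open>The winding number\<close>

text \<open>Two obstacles shape the argument. Their link with zeros comes from dividing out one zero
  after another: a factor \<open>(z - w) ^ n\<close> contributes \<open>n\<close>, and a function
  without zeros on the closed disc contributes 0. Moreover, a curve with centre in the open polydisk
  meets only the open polydisk and the torus, never a boundary point with some coordinates of
  modulus 1 and others smaller. Such points are reached as limits only, and absence of zeros does
  not pass to limits. A uniform lower bound does, which is why the minimum of the modulus on the
  torus has to enter.\<close>

lemma exp_in_circle: "exp (\<i> * complex_of_real t) \<in> circle"
  by (simp add: circle_def)

lemma compact_circle: "compact circle"
proof -
  have "circle = sphere 0 1" by (auto simp: circle_def)
  then show ?thesis by (metis compact_sphere)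
qed

section \<open>Winding numbers through continuous logarithms\<close>

lemma wind_cong:
  assumes "\<And>z. z \<in> circle \<Longrightarrow> h z = k z"
  shows "wind h = wind k"
  unfolding wind_def by (simp add: assms exp_in_circle)

text \<open>The imaginary part of a continuous logarithm is a continuous argument, and its real
  parts at both ends agree because the circle closes up. The remaining work shows that the
  description in \<open>wind\<close> singles out one integer; afterwards winding numbers are
  computed from logarithms.\<close>

lemma wind_eq_log:
  assumes cont: "continuous_on {0..2 * pi} G"
    and log: "\<And>t. t \<in> {0..2 * pi} \<Longrightarrow> h (exp (\<i> * of_real t)) = exp (G t)"
  shows "2 * pi * \<i> * of_int (wind h) = G (2 * pi) - G 0"
proof -
  have "exp (G (2 * pi)) = exp (G 0)"
    using log[of "2 * pi"] log[of 0] by (simp add: mult_ac)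
  then obtain n :: int where n: "G (2 * pi) = G 0 + of_int (2 * n) * pi * \<i>"
    unfolding exp_eq by blast
  have polar: "exp w = of_real (cmod (exp w)) * exp (\<i> * of_real (Im w))" for w
    by (metis exp_eq_polar cis_conv_exp norm_exp_eq_Re)
  have "wind h = n"
    unfolding wind_def
  proof (rule the_equality)
    have "continuous_on {0..2 * pi} (\<lambda>t. Im (G t))"
      by (intro continuous_intros cont)
    moreover have "real_of_int n = 1 / (2 * pi) * (Im (G (2 * pi)) - Im (G 0))"
      by (simp add: n)
    ultimately show "\<exists>\<Theta> :: real \<Rightarrow> real. continuous_on {0..2 * pi} \<Theta> \<and>
       (\<forall>t\<in>{0..2 * pi}. h (exp (\<i> * of_real t)) =
          of_real (cmod (h (exp (\<i> * of_real t)))) * exp (\<i> * of_real (\<Theta> t))) \<and>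
       real_of_int n = 1 / (2 * pi) * (\<Theta> (2 * pi) - \<Theta> 0)"
      by (intro exI[of _ "\<lambda>t. Im (G t)"]) (use log polar[symmetric] in simp)
  next
    fix k :: int
    assume "\<exists>\<Theta> :: real \<Rightarrow> real. continuous_on {0..2 * pi} \<Theta> \<and>
       (\<forall>t\<in>{0..2 * pi}. h (exp (\<i> * of_real t)) =
          of_real (cmod (h (exp (\<i> * of_real t)))) * exp (\<i> * of_real (\<Theta> t))) \<and>
       real_of_int k = 1 / (2 * pi) * (\<Theta> (2 * pi) - \<Theta> 0)"
    then obtain \<Theta> :: "real \<Rightarrow> real" where \<Theta>: "continuous_on {0..2 * pi} \<Theta>"
      and arg: "\<And>t. t \<in> {0..2 * pi} \<Longrightarrow> h (exp (\<i> * of_real t)) =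
          of_real (cmod (h (exp (\<i> * of_real t)))) * exp (\<i> * of_real (\<Theta> t))"
      and k: "real_of_int k = 1 / (2 * pi) * (\<Theta> (2 * pi) - \<Theta> 0)"
      by blast
    \<comment> \<open>\<open>D\<close> compares an arbitrary argument with the one coming from
      \<open>G\<close>. It is continuous with values in \<open>2 * pi\<close> times the integers,
      hence constant on the interval, so both arguments have the same end difference.\<close>
    define D where "D t = \<Theta> t - Im (G t)" for t
    have D: "\<exists>m::int. D t = 2 * pi * m" if t: "t \<in> {0..2 * pi}" for t
    proof -
      have "of_real (cmod (exp (G t))) * exp (\<i> * of_real (Im (G t)))
          = of_real (cmod (exp (G t))) * exp (\<i> * of_real (\<Theta> t))"
        using arg[OF t] polar[of "G t"] log[OF t] by metis
      then have "exp (\<i> * of_real (\<Theta> t)) = exp (\<i> * of_real (Im (G t)))"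
        by simp
      then obtain m :: int where "\<i> * of_real (\<Theta> t) = \<i> * of_real (Im (G t)) + of_int (2 * m) * pi * \<i>"
        unfolding exp_eq by blast
      then have "Im (\<i> * of_real (\<Theta> t)) = Im (\<i> * of_real (Im (G t)) + of_int (2 * m) * pi * \<i>)"
        by simp
      then show ?thesis by (auto simp: D_def intro!: exI[of _ m])
    qed
    have "D constant_on {0..2 * pi}"
    proof (rule continuous_discrete_range_constant)
      show "continuous_on {0..2 * pi} D"
        unfolding D_def by (intro continuous_intros \<Theta> cont)
      fix s assume s: "s \<in> {0..2 * pi}"
      show "\<exists>e>0. \<forall>t. t \<in> {0..2 * pi} \<and> D t \<noteq> D s \<longrightarrow> e \<le> norm (D t - D s)"
      proof (intro exI[of _ "2 * pi"] conjI allI impI)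
        fix t assume t: "t \<in> {0..2 * pi} \<and> D t \<noteq> D s"
        obtain m l :: int where ml: "D t = 2 * pi * m" "D s = 2 * pi * l"
          using D s t by meson
        then have "1 \<le> \<bar>m - l\<bar>" using t by auto
        then have "1 \<le> \<bar>real_of_int m - real_of_int l\<bar>" by linarith
        then show "2 * pi \<le> norm (D t - D s)"
          by (simp add: ml abs_mult flip: right_diff_distrib)
      qed simp
    qed simp
    then have "D (2 * pi) = D 0" by (force simp: constant_on_def)
    moreover have "Im (G (2 * pi)) = Im (G 0) + 2 * pi * n" by (simp add: n)
    ultimately have "\<Theta> (2 * pi) - \<Theta> 0 = 2 * pi * n"
      by (simp add: D_def)
    with k show "k = n" by simp
  qed
  then show ?thesis by (simp add: n)
qed

lemma two_pi_i_cancel: "2 * pi * \<i> * of_int a = 2 * pi * \<i> * of_int b \<Longrightarrow> a = b"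
  by simp

text \<open>The logarithm lives on the interval of angles, which is contractible, unlike the circle.
  The mismatch of its end values is what \<open>wind\<close> measures.\<close>

lemma log_on_circle:
  fixes h :: "complex \<Rightarrow> complex"
  assumes "continuous_on circle h" "\<And>z. z \<in> circle \<Longrightarrow> h z \<noteq> 0"
  obtains G where "continuous_on {0..2 * pi} G"
    "\<And>t. t \<in> {0..2 * pi} \<Longrightarrow> h (exp (\<i> * of_real t)) = exp (G t)"
proof -
  have "continuous_on {0..2 * pi} (\<lambda>t. h (exp (\<i> * of_real t)))"
    by (intro continuous_on_compose2[OF assms(1)] continuous_intros) (auto simp: exp_in_circle)
  moreover have "contractible {0..2 * pi}" by (simp add: convex_imp_contractible)
  moreover have "h (exp (\<i> * of_real t)) \<noteq> 0" for t
    using assms(2) exp_in_circle by blast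
  ultimately show ?thesis
    using continuous_logarithm_on_contractible[of "{0..2 * pi}" "\<lambda>t. h (exp (\<i> * of_real t))"] that
    by blast
qed

lemma wind_mult:
  assumes "continuous_on circle h" "\<And>z. z \<in> circle \<Longrightarrow> h z \<noteq> 0"
    and "continuous_on circle k" "\<And>z. z \<in> circle \<Longrightarrow> k z \<noteq> 0"
  shows "wind (\<lambda>z. h z * k z) = wind h + wind k"
proof -
  obtain G where G: "continuous_on {0..2 * pi} G"
    "\<And>t. t \<in> {0..2 * pi} \<Longrightarrow> h (exp (\<i> * of_real t)) = exp (G t)"
    using log_on_circle[OF assms(1,2)] by blast
  obtain H where H: "continuous_on {0..2 * pi} H"
    "\<And>t. t \<in> {0..2 * pi} \<Longrightarrow> k (exp (\<i> * of_real t)) = exp (H t)"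
    using log_on_circle[OF assms(3,4)] by blast
  have "2 * pi * \<i> * of_int (wind (\<lambda>z. h z * k z)) = (G (2 * pi) + H (2 * pi)) - (G 0 + H 0)"
    by (rule wind_eq_log[where G = "\<lambda>t. G t + H t"])
      (auto intro!: continuous_intros G H simp: G H exp_add)
  also have "\<dots> = 2 * pi * \<i> * of_int (wind h + wind k)"
    by (simp only: of_int_add distrib_left wind_eq_log[OF G] wind_eq_log[OF H]) simp
  finally show ?thesis by (rule two_pi_i_cancel)
qed

lemma wind_cnj:
  assumes "continuous_on circle h" "\<And>z. z \<in> circle \<Longrightarrow> h z \<noteq> 0"
  shows "wind (\<lambda>z. cnj (h z)) = - wind h"
proof -
  obtain G where G: "continuous_on {0..2 * pi} G"
    "\<And>t. t \<in> {0..2 * pi} \<Longrightarrow> h (exp (\<i> * of_real t)) = exp (G t)"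
    using log_on_circle[OF assms] by blast
  have "2 * pi * \<i> * of_int (wind (\<lambda>z. cnj (h z))) = cnj (G (2 * pi)) - cnj (G 0)"
    by (rule wind_eq_log[where G = "\<lambda>t. cnj (G t)"])
      (auto intro!: continuous_intros G simp: G exp_cnj)
  also have "\<dots> = cnj (2 * pi * \<i> * of_int (wind h))"
    using wind_eq_log[OF G] by simp
  also have "\<dots> = 2 * pi * \<i> * of_int (- wind h)" by simp
  finally show ?thesis by (rule two_pi_i_cancel)
qed

text \<open>A logarithm defined on the circle itself returns to its initial value at the angle
  \<open>2 * pi\<close>.\<close>

lemma wind_exp:
  assumes "continuous_on circle g"
  shows "wind (\<lambda>z. exp (g z)) = 0"
proof -
  have "2 * pi * \<i> * of_int (wind (\<lambda>z. exp (g z))) = g (exp (\<i> * of_real (2 * pi))) - g (exp (\<i> * of_real 0))"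
    by (rule wind_eq_log[where G = "\<lambda>t. g (exp (\<i> * of_real t))"])
      (auto intro!: continuous_on_compose2[OF assms] continuous_intros exp_in_circle)
  then show ?thesis by (simp add: mult_ac)
qed

lemma wind_id: "wind (\<lambda>z. z) = 1"
proof -
  have "2 * pi * \<i> * of_int (wind (\<lambda>z. z)) = \<i> * of_real (2 * pi) - \<i> * of_real 0"
    by (rule wind_eq_log) (auto intro!: continuous_intros)
  then have "complex_of_int (wind (\<lambda>z. z)) = of_int 1" by simp
  then show ?thesis by (simp only: of_int_eq_iff)
qed

text \<open>Rouche's argument: \<open>k / h\<close> stays in the disc of radius 1 about 1, where
  \<open>Ln\<close> is continuous, so \<open>k\<close> is \<open>h\<close> times a function with a
  logarithm on the circle.\<close>

lemma wind_perturb: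
  assumes h: "continuous_on circle h" and k: "continuous_on circle k"
    and close: "\<And>z. z \<in> circle \<Longrightarrow> cmod (k z - h z) < cmod (h z)"
  shows "wind k = wind h"
proof -
  have nz: "h z \<noteq> 0" if "z \<in> circle" for z
    using close[OF that] by force
  have Re: "k z / h z \<notin> \<real>\<^sub>\<le>\<^sub>0" if "z \<in> circle" for z
  proof -
    have "cmod (k z / h z - 1) < 1"
      using close[OF that] nz[OF that]
      by (simp add: divide_diff_eq_iff norm_divide)
    then have "Re (k z / h z) > 0"
      using complex_Re_le_cmod[of "1 - k z / h z"] by (simp add: norm_minus_commute)
    then show ?thesis by (auto simp: complex_nonpos_Reals_iff)
  qed
  have "wind k = wind (\<lambda>z. h z * exp (Ln (k z / h z)))"
  proof (rule wind_cong)
    fix z assume z: "z \<in> circle"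
    then have "k z / h z \<noteq> 0" using Re[OF z] by force
    then show "k z = h z * exp (Ln (k z / h z))" using nz[OF z] by simp
  qed
  also have "\<dots> = wind h + wind (\<lambda>z. exp (Ln (k z / h z)))"
    by (rule wind_mult) (use h k nz Re in \<open>auto intro!: continuous_intros\<close>)
  also have "wind (\<lambda>z. exp (Ln (k z / h z))) = 0"
    by (rule wind_exp) (use h k nz Re in \<open>auto intro!: continuous_intros\<close>)
  finally show ?thesis by simp
qed

text \<open>One logarithm is taken on the whole rectangle of deformation parameter and angle, which
  is contractible. This makes the end difference continuous in the parameter.\<close>

lemma wind_homotopic:
  fixes H :: "real \<Rightarrow> complex \<Rightarrow> complex"
  assumes cont: "continuous_on ({0..1} \<times> circle) (\<lambda>(s, z). H s z)"
    and nz: "\<And>s z. s \<in> {0..1} \<Longrightarrow> z \<in> circle \<Longrightarrow> H s z \<noteq> 0"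
  shows "wind (H 0) = wind (H 1)"
proof -
  have "continuous_on ({0..1} \<times> {0..2 * pi}) (\<lambda>x. case (fst x, exp (\<i> * of_real (snd x))) of (s, z) \<Rightarrow> H s z)"
    by (rule continuous_on_compose2[OF cont, where f = "\<lambda>x. (fst x, exp (\<i> * of_real (snd x)))"])
      (auto intro!: continuous_intros exp_in_circle)
  then have "continuous_on ({0..1} \<times> {0..2 * pi}) (\<lambda>x. H (fst x) (exp (\<i> * of_real (snd x))))"
    by simp
  moreover have "contractible ({0..1::real} \<times> {0..2 * pi})"
    by (intro convex_imp_contractible convex_Times) auto
  moreover have "H (fst x) (exp (\<i> * of_real (snd x))) \<noteq> 0" if "x \<in> {0..1} \<times> {0..2 * pi}" for x
    using nz[of "fst x"] exp_in_circle that by auto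
  ultimately obtain G where G: "continuous_on ({0..1} \<times> {0..2 * pi}) G"
    and log: "\<And>x. x \<in> {0..1} \<times> {0..2 * pi} \<Longrightarrow> H (fst x) (exp (\<i> * of_real (snd x))) = exp (G x)"
    using continuous_logarithm_on_contractible[of "{0..1} \<times> {0..2 * pi}" "\<lambda>x. H (fst x) (exp (\<i> * of_real (snd x)))"]
    by blast
  have wind: "2 * pi * \<i> * of_int (wind (H s)) = G (s, 2 * pi) - G (s, 0)" if s: "s \<in> {0..1}" for s
  proof (rule wind_eq_log)
    show "continuous_on {0..2 * pi} (\<lambda>t. G (s, t))"
      using s by (intro continuous_on_compose2[OF G] continuous_intros) auto
    show "H s (exp (\<i> * of_real t)) = exp (G (s, t))" if "t \<in> {0..2 * pi}" for t
      using log[of "(s, t)"] s that by simp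
  qed
  \<comment> \<open>The winding number of \<open>H s\<close> in a form whose continuity in
    \<open>s\<close> is visible; being integer-valued, it is constant.\<close>
  define D where "D s = (G (s, 2 * pi) - G (s, 0)) / (2 * pi * \<i>)" for s
  have D: "D s = of_int (wind (H s))" if "s \<in> {0..1}" for s
    unfolding D_def wind[OF that, symmetric] by simp
  have "D constant_on {0..1}"
  proof (rule continuous_discrete_range_constant)
    show "continuous_on {0..1} D"
      unfolding D_def by (intro continuous_on_compose2[OF G] continuous_intros) auto
    fix s :: real assume s: "s \<in> {0..1}"
    show "\<exists>e>0. \<forall>t. t \<in> {0..1} \<and> D t \<noteq> D s \<longrightarrow> e \<le> cmod (D t - D s)"
    proof (intro exI[of _ 1] conjI allI impI)
      fix t assume t: "t \<in> {0..1} \<and> D t \<noteq> D s"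
      then have "1 \<le> \<bar>wind (H t) - wind (H s)\<bar>" using D s by fastforce
      then have "1 \<le> cmod (of_int (wind (H t) - wind (H s)))"
        unfolding norm_of_int by linarith
      then show "1 \<le> cmod (D t - D s)" using t s by (simp add: D)
    qed simp
  qed simp
  then have "D 0 = D 1" by (force simp: constant_on_def)
  then show ?thesis by (simp add: D)
qed

section \<open>Winding numbers of powers, linear factors and functions without zeros in the
  disc\<close>

lemma wind_power:
  assumes "continuous_on circle h" "\<And>z. z \<in> circle \<Longrightarrow> h z \<noteq> 0"
  shows "wind (\<lambda>z. h z ^ n) = int n * wind h"
proof (induction n)
  case 0
  have "wind (\<lambda>z. exp 0) = 0" by (rule wind_exp) simp
  then show ?case by simp
next
  case (Suc n)
  have "wind (\<lambda>z. h z * h z ^ n) = wind h + wind (\<lambda>z. h z ^ n)"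
    by (rule wind_mult) (use assms in \<open>auto intro!: continuous_intros\<close>)
  with Suc show ?case by (simp add: algebra_simps)
qed

text \<open>On the circle the shift by \<open>w\<close> is smaller than the modulus 1 of
  \<open>z\<close>, so \<open>wind_perturb\<close> compares with the identity.\<close>

lemma wind_diff:
  assumes "cmod w < 1"
  shows "wind (\<lambda>z. z - w) = 1"
proof -
  have "wind (\<lambda>z. z - w) = wind (\<lambda>z. z)"
    by (rule wind_perturb) (use assms in \<open>auto intro!: continuous_intros simp: circle_def\<close>)
  then show ?thesis by (simp add: wind_id)
qed

text \<open>On the full disc a function without zeros has a logarithm. This is the base of the zero
  count below and, applied to the diagonal, the forward half of (A4).\<close>

lemma wind_nonvanishing_disc:
  assumes "continuous_on (cball 0 1) h" "\<And>z. z \<in> cball 0 1 \<Longrightarrow> h z \<noteq> 0"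
  shows "wind h = 0"
proof -
  obtain g where g: "continuous_on (cball 0 1) g" "\<And>z. z \<in> cball 0 1 \<Longrightarrow> h z = exp (g z)"
    using continuous_logarithm_on_cball[of 0 1 h] assms by blast
  have sub: "circle \<subseteq> cball 0 1" by (auto simp: circle_def)
  have "wind h = wind (\<lambda>z. exp (g z))"
    by (rule wind_cong) (use sub g(2) in blast)
  with g(1) sub show ?thesis by (simp add: wind_exp continuous_on_subset)
qed

section \<open>Zeros of functions in the disc algebra\<close>

text \<open>A constant function with a zero inside would be 0 on the open disc and, by continuity,
  at the boundary point 1. Being nonconstant makes the zeros isolated and of finite order.\<close>

lemma nonconstant_disc:
  fixes h :: "complex \<Rightarrow> complex"
  assumes "continuous_on (cball 0 1) h" "\<And>z. z \<in> circle \<Longrightarrow> h z \<noteq> 0"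
    and "w \<in> ball 0 1" "h w = 0"
  shows "\<not> h constant_on ball 0 1"
proof
  assume "h constant_on ball 0 1"
  then have "h z = 0" if "z \<in> ball 0 1" for z
    using assms(3,4) that unfolding constant_on_def by metis
  then have "h 1 = 0"
    using continuous_constant_on_closure[of "ball 0 1" h 0 1] assms(1) by simp
  with assms(2)[of 1] show False by (simp add: circle_def)
qed

text \<open>The zeros form a closed set that avoids the circle, hence a compact subset of the open
  disc; isolated zeros then leave only finitely many.\<close>

lemma finite_zeros_disc:
  assumes cont: "continuous_on (cball 0 1) h" and hol: "h holomorphic_on ball 0 1"
    and nz: "\<And>z. z \<in> circle \<Longrightarrow> h z \<noteq> 0"
  shows "finite {z \<in> cball 0 1. h z = 0}"
proof (cases "{z \<in> cball 0 1. h z = 0} = {}")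
  case True
  then show ?thesis by (metis finite.emptyI)
next
  case False
  define K where "K = {z \<in> cball 0 1. h z = 0}"
  have K: "K \<subseteq> ball 0 1"
    using nz by (force simp: K_def circle_def)
  obtain w where w: "w \<in> K" using False by (auto simp: K_def)
  have "closed K"
    unfolding K_def using continuous_closed_preimage_constant[OF cont closed_cball] by simp
  then have "compact K"
    using K bounded_subset[OF bounded_ball] compact_eq_bounded_closed by blast
  moreover have "\<not> h constant_on ball 0 1"
    using nonconstant_disc[OF cont nz, of w] w K by (auto simp: K_def)
  ultimately have "finite {z \<in> K. h z = 0}"
    using holomorphic_compact_finite_zeros[OF hol] K by auto
  then show ?thesis by (simp add: K_def)
qed

text \<open>A form of the argument principle for functions merely continuous up to the circle.
  Distinct zeros are counted, and the induction removes one zero \<open>w\<close> with its full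
  order \<open>n\<close>: dividing by \<open>(z - w) ^ n\<close> lowers the count by 1 and the
  winding number by \<open>n\<close>, which is at least 1.\<close>

lemma wind_holomorphic_ge_card_zeros:
  assumes "continuous_on (cball 0 1) h" "h holomorphic_on ball 0 1" "\<And>z. z \<in> circle \<Longrightarrow> h z \<noteq> 0"
  shows "finite {z \<in> cball 0 1. h z = 0} \<and> int (card {z \<in> cball 0 1. h z = 0}) \<le> wind h"
  using assms
proof (induction "card {z \<in> cball 0 1. h z = 0}" arbitrary: h)
  case (0 h)
  \<comment> \<open>\<open>card\<close> is 0 for infinite sets too, so only together with finiteness
    does the count 0 mean that there are no zeros. The first conjunct of the claim has the same
    reason.\<close>
  have fin: "finite {z \<in> cball 0 1. h z = 0}"
    by (rule finite_zeros_disc[OF 0(2-4)])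
  then have "wind h = 0"
    using 0 by (intro wind_nonvanishing_disc) auto
  with 0 fin show ?case by simp
next
  case (Suc m h)
  have fin: "finite {z \<in> cball 0 1. h z = 0}"
    by (rule finite_zeros_disc[OF Suc.prems])
  obtain w where w: "w \<in> cball 0 1" "h w = 0"
    using Suc.hyps(2) by (metis (mono_tags, lifting) card.empty empty_Collect_eq nat.distinct(1))
  have wb: "w \<in> ball 0 1"
    using w Suc.prems(3)[of w] by (force simp: circle_def)
  have nonconst: "\<not> h constant_on ball 0 1"
    by (rule nonconstant_disc[OF Suc.prems(1,3) wb w(2)])
  obtain g r n where n: "0 < n" and r: "0 < r" "ball w r \<subseteq> ball 0 1"
    and g: "g holomorphic_on ball w r"
    and hg: "\<And>z. z \<in> ball w r \<Longrightarrow> h z = (z - w) ^ n * g z"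
    and gnz: "\<And>z. z \<in> ball w r \<Longrightarrow> g z \<noteq> 0"
    by (rule holomorphic_factor_zero_nonconstant[OF Suc.prems(2) open_ball connected_ball wb w(2) nonconst])
      blast
  \<comment> \<open>The quotient with its removable singularity filled: the value at
    \<open>w\<close> comes from the local factor \<open>g\<close>, all others from the plain
    quotient, which also makes sense on the circle, away from the domain of
    \<open>g\<close>.\<close>
  define k where "k z = (if z = w then g w else h z / (z - w) ^ n)" for z
  have kg: "k z = g z" if "z \<in> ball w r" for z
    using hg[OF that] by (simp add: k_def)
  have hk: "h z = (z - w) ^ n * k z" for z
    using w(2) n by (simp add: k_def)
  have knz: "k w \<noteq> 0"
    using gnz r by (simp add: k_def)
  have hol_k: "k holomorphic_on ball 0 1"
  proof -
    have "k holomorphic_on ball w r"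
      using g by (rule holomorphic_transform) (simp add: kg)
    moreover have "k holomorphic_on (ball 0 1 - {w})"
    proof (rule holomorphic_transform)
      show "(\<lambda>z. h z / (z - w) ^ n) holomorphic_on (ball 0 1 - {w})"
        by (intro holomorphic_intros holomorphic_on_subset[OF Suc.prems(2)]) auto
    qed (simp add: k_def)
    ultimately have "k holomorphic_on (ball w r \<union> (ball 0 1 - {w}))"
      by (rule holomorphic_on_Un) auto
    then show ?thesis
      by (rule holomorphic_on_subset) (use r in auto)
  qed
  have cont_k: "continuous_on (cball 0 1) k"
  proof -
    \<comment> \<open>Continuity is glued from two closed sets: a disc of radius
      \<open>r / 2\<close> inside the open disc, where \<open>k\<close> is holomorphic, and the rest
      of the closed disc, which keeps its distance from \<open>w\<close>.\<close>
    have "cball w (r / 2) \<subseteq> ball 0 1"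
      using r by (auto simp: subset_iff)
    then have "continuous_on (cball w (r / 2)) k"
      using hol_k holomorphic_on_imp_continuous_on holomorphic_on_subset by blast
    moreover have "continuous_on (cball 0 1 - ball w (r / 2)) k"
    proof (rule continuous_on_eq)
      show "continuous_on (cball 0 1 - ball w (r / 2)) (\<lambda>z. h z / (z - w) ^ n)"
        using r(1) by (intro continuous_intros continuous_on_subset[OF Suc.prems(1)]) auto
    qed (use r(1) in \<open>auto simp: k_def\<close>)
    ultimately have "continuous_on (cball w (r / 2) \<union> (cball 0 1 - ball w (r / 2))) k"
      by (intro continuous_on_closed_Un closed_Diff) auto
    then show ?thesis
      by (rule continuous_on_subset) auto
  qed
  have nz_k: "k z \<noteq> 0" if "z \<in> circle" for z
    using Suc.prems(3)[OF that] hk[of z] by auto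
  have nz_w: "z - w \<noteq> 0" if "z \<in> circle" for z
    using that wb by (auto simp: circle_def)
  have circle: "circle \<subseteq> cball 0 1" by (auto simp: circle_def)
  have zeros: "{z \<in> cball 0 1. k z = 0} = {z \<in> cball 0 1. h z = 0} - {w}"
    using knz hk n by auto
  then have "m = card {z \<in> cball 0 1. k z = 0}"
    using Suc.hyps(2) w by simp
  then have IH: "int m \<le> wind k"
    using Suc.hyps(1)[OF _ cont_k hol_k nz_k] by simp
  have "wind h = wind (\<lambda>z. (z - w) ^ n * k z)"
    by (rule wind_cong) (rule hk)
  also have "\<dots> = wind (\<lambda>z. (z - w) ^ n) + wind k"
    by (rule wind_mult)
      (use nz_k nz_w continuous_on_subset[OF cont_k circle] in \<open>auto intro!: continuous_intros\<close>)
  also have "wind (\<lambda>z. (z - w) ^ n) = int n * wind (\<lambda>z. z - w)"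
    by (rule wind_power) (use nz_w in \<open>auto intro!: continuous_intros\<close>)
  also have "wind (\<lambda>z. z - w) = 1"
    using wb by (simp add: wind_diff)
  finally have "int (Suc m) \<le> wind h" using IH n by simp
  with fin Suc.hyps(2) show ?case by simp
qed

section \<open>Functions on the polydisk\<close>

lemma open_open_polydisk: "open (open_polydisk :: (complex ^ 'n) set)"
proof -
  have "open (\<Inter>i. {z :: complex ^ 'n. cmod (z $ i) < 1})"
    by (intro open_INT ballI open_Collect_less continuous_intros) simp
  then show ?thesis by (simp add: open_polydisk_def Collect_all_eq)
qed

lemma closed_closed_polydisk: "closed (closed_polydisk :: (complex ^ 'n) set)"
  unfolding closed_polydisk_def by (intro closed_Collect_all closed_Collect_le continuous_intros)

lemma torus_subset: "torus \<subseteq> (closed_polydisk :: (complex ^ 'n) set)"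
  by (auto simp: torus_def closed_polydisk_def)

lemma open_polydisk_subset: "open_polydisk \<subseteq> (closed_polydisk :: (complex ^ 'n) set)"
  by (auto simp: open_polydisk_def closed_polydisk_def less_imp_le)

lemma compact_torus: "compact (torus :: (complex ^ 'n) set)"
proof -
  have "closed (torus :: (complex ^ 'n) set)"
    unfolding torus_def by (intro closed_Collect_all closed_Collect_eq continuous_intros)
  moreover have "bounded (torus :: (complex ^ 'n) set)"
  proof (rule boundedI)
    fix z :: "complex ^ 'n" assume "z \<in> torus"
    then show "norm z \<le> (\<Sum>i\<in>(UNIV :: 'n set). 1)"
      using L2_set_le_sum[of UNIV "\<lambda>i. cmod (z $ i)"] by (simp add: torus_def norm_vec_def)
  qed
  ultimately show ?thesis by (simp add: compact_eq_bounded_closed)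
qed

text \<open>Scaling a point by factors that tend to 1 from below moves it into the open polydisk.
  This density carries estimates and identities from the open polydisk to its boundary.\<close>

lemma closure_open_polydisk: "closure open_polydisk = (closed_polydisk :: (complex ^ 'n) set)"
proof
  show "closure open_polydisk \<subseteq> (closed_polydisk :: (complex ^ 'n) set)"
    by (rule closure_minimal[OF open_polydisk_subset closed_closed_polydisk])
  show "closed_polydisk \<subseteq> closure (open_polydisk :: (complex ^ 'n) set)"
  proof
    fix z :: "complex ^ 'n" assume z: "z \<in> closed_polydisk"
    define r :: "nat \<Rightarrow> real" where "r n = 1 - inverse (real (Suc n))" for n
    have r: "0 \<le> r n" "r n < 1" for n
      by (auto simp: r_def field_simps)
    have "r n *\<^sub>R z \<in> open_polydisk" for n
      unfolding open_polydisk_def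
    proof (intro CollectI allI)
      fix i
      have "cmod ((r n *\<^sub>R z) $ i) = r n * cmod (z $ i)"
        using r(1)[of n] by simp
      also have "\<dots> \<le> r n"
        using z r(1)[of n] by (simp add: closed_polydisk_def mult_left_le)
      finally show "cmod ((r n *\<^sub>R z) $ i) < 1" using r(2)[of n] by linarith
    qed
    moreover have "r \<longlonglongrightarrow> 1 - 0"
      unfolding r_def by (intro tendsto_diff tendsto_const LIMSEQ_inverse_real_of_nat)
    then have "(\<lambda>n. r n *\<^sub>R z) \<longlonglongrightarrow> 1 *\<^sub>R z"
      by (intro tendsto_intros) simp
    ultimately show "z \<in> closure open_polydisk"
      unfolding closure_sequential by force
  qed
qed

text \<open>Chain rule: the derivative of \<open>c\<close> sends \<open>y\<close> to
  \<open>y *s d\<close>, and complex linearity of \<open>f'\<close> turns \<open>f' (y *s d)\<close>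
  into \<open>y * f' d\<close>. This brings one-variable theory to curves and lines in the
  polydisk.\<close>

lemma holomorphic_several_on_compose:
  fixes f :: "complex ^ 'n \<Rightarrow> complex" and c :: "complex \<Rightarrow> complex ^ 'n"
  assumes hol: "holomorphic_several_on f U" and "open V"
    and c: "\<And>i. (\<lambda>x. c x $ i) holomorphic_on V" and maps: "c ` V \<subseteq> U"
  shows "(\<lambda>x. f (c x)) holomorphic_on V"
proof -
  have "\<exists>D. ((\<lambda>x. f (c x)) has_field_derivative D) (at x)" if x: "x \<in> V" for x
  proof -
    obtain f' where f': "(f has_derivative f') (at (c x))" and lin: "\<And>a v. f' (a *s v) = a * f' v"
      using hol maps x unfolding holomorphic_several_on_def by blast
    define d :: "complex ^ 'n" where "d = (\<chi> i. deriv (\<lambda>x. c x $ i) x)"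
    have "((\<lambda>x. c x $ i) has_derivative (\<lambda>y. (y *s d) $ i)) (at x)" for i
      using holomorphic_derivI[OF c \<open>open V\<close> x, of i]
      by (simp add: has_field_derivative_def d_def mult.commute[of _ "deriv _ _"])
    \<comment> \<open>Vector-valued differentiability is tested against the real basis. Its members
      are \<open>axis i e\<close> with \<open>e\<close> in the basis of the complex numbers, and the
      inner product with such a vector sees coordinate \<open>i\<close> only.\<close>
    note comp = has_derivative_inner_left[OF this]
    have "((\<lambda>x. c x \<bullet> b) has_derivative (\<lambda>y. (y *s d) \<bullet> b)) (at x)" if b: "b \<in> Basis" for b
    proof -
      obtain i e where "b = axis i e" using b by (auto simp: Basis_vec_def)
      then show ?thesis using comp[of i e] by (simp only: inner_axis)
    qed
    then have "(c has_derivative (\<lambda>y. y *s d)) (at x)"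
      by (subst has_derivative_componentwise_within) blast
    from has_derivative_compose[OF this f']
    have "((\<lambda>x. f (c x)) has_derivative (\<lambda>y. f' d * y)) (at x)"
      by (simp add: lin mult.commute)
    then show ?thesis unfolding has_field_derivative_def by blast
  qed
  then show ?thesis
    using \<open>open V\<close> by (auto simp: holomorphic_on_open)
qed

section \<open>Analytic discs through a given point with boundary in the torus\<close>

definition mobius_curve :: "complex ^ 'n \<Rightarrow> complex \<Rightarrow> complex ^ 'n" where
  "mobius_curve a z = (\<chi> i. (z + a $ i) / (1 + cnj (a $ i) * z))"

lemma mobius_denominator:
  assumes "cmod a < 1" "cmod z \<le> 1"
  shows "1 + cnj a * z \<noteq> 0"
proof
  assume "1 + cnj a * z = 0"
  then have "cmod (cnj a * z) = 1"
    by (metis add_eq_0_iff norm_minus_cancel norm_one)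
  moreover have "cmod (cnj a * z) \<le> cmod a * 1"
    unfolding norm_mult complex_mod_cnj by (rule mult_left_mono) (use assms in auto)
  ultimately show False using assms(1) by simp
qed

text \<open>The mixed terms on the left cancel and the rest factors. For \<open>cmod a < 1\<close>
  the sign is that of the factor containing \<open>z\<close>, which settles the closed, the open and
  the boundary case of \<open>mobius_curve_mem\<close> alike.\<close>

lemma mobius_norm_identity:
  "(cmod (1 + cnj a * z))\<^sup>2 - (cmod (z + a))\<^sup>2 = (1 - (cmod a)\<^sup>2) * (1 - (cmod z)\<^sup>2)"
  by (simp only: cmod_power2) (simp add: power2_eq_square algebra_simps)

lemma mobius_curve_mem:
  fixes a :: "complex ^ 'n"
  assumes a: "a \<in> open_polydisk"
  shows "cmod z \<le> 1 \<Longrightarrow> mobius_curve a z \<in> closed_polydisk"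
    and "cmod z < 1 \<Longrightarrow> mobius_curve a z \<in> open_polydisk"
    and "cmod z = 1 \<Longrightarrow> mobius_curve a z \<in> torus"
proof -
  have a1: "cmod (a $ i) < 1" for i
    using a by (simp add: open_polydisk_def)
  have pos: "0 < 1 - (cmod (a $ i))\<^sup>2" for i
    using a1[of i] by (simp add: power_less_one_iff)
  show "mobius_curve a z \<in> closed_polydisk" if z: "cmod z \<le> 1"
    unfolding closed_polydisk_def
  proof (intro CollectI allI)
    fix i
    have "0 \<le> 1 - (cmod z)\<^sup>2" using z by (simp add: power_le_one)
    then have "(cmod (z + a $ i))\<^sup>2 \<le> (cmod (1 + cnj (a $ i) * z))\<^sup>2"
      using mobius_norm_identity[of "a $ i" z] pos[of i]
      by (metis diff_ge_0_iff_ge less_imp_le mult_nonneg_nonneg)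
    then have "cmod (z + a $ i) \<le> cmod (1 + cnj (a $ i) * z)"
      by (rule power2_le_imp_le) simp
    then show "cmod (mobius_curve a z $ i) \<le> 1"
      using mobius_denominator[OF a1 z] by (simp add: mobius_curve_def norm_divide)
  qed
  show "mobius_curve a z \<in> open_polydisk" if z: "cmod z < 1"
    unfolding open_polydisk_def
  proof (intro CollectI allI)
    fix i
    have "0 < 1 - (cmod z)\<^sup>2" using z by (simp add: power_less_one_iff)
    then have "(cmod (z + a $ i))\<^sup>2 < (cmod (1 + cnj (a $ i) * z))\<^sup>2"
      using mobius_norm_identity[of "a $ i" z] pos[of i]
      by (metis diff_gt_0_iff_gt mult_pos_pos)
    then have "cmod (z + a $ i) < cmod (1 + cnj (a $ i) * z)"
      by (rule power2_less_imp_less) simp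
    then show "cmod (mobius_curve a z $ i) < 1"
      using mobius_denominator[OF a1, of z i] z by (simp add: mobius_curve_def norm_divide)
  qed
  show "mobius_curve a z \<in> torus" if z: "cmod z = 1"
    unfolding torus_def
  proof (intro CollectI allI)
    fix i
    have "(cmod (z + a $ i))\<^sup>2 = (cmod (1 + cnj (a $ i) * z))\<^sup>2"
      using mobius_norm_identity[of "a $ i" z] z by simp
    then have "cmod (z + a $ i) = cmod (1 + cnj (a $ i) * z)"
      by (rule power2_eq_imp_eq) simp_all
    then show "cmod (mobius_curve a z $ i) = 1"
      using mobius_denominator[OF a1, of z i] z by (simp add: mobius_curve_def norm_divide)
  qed
qed

lemma mobius_curve_at_0 [simp]: "mobius_curve a 0 = a"
  by (simp add: mobius_curve_def vec_eq_iff)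

lemma mobius_curve_centre_0 [simp]: "mobius_curve 0 z = (\<chi> i. z)"
  by (simp add: mobius_curve_def vec_eq_iff)

section \<open>Maximum modulus and absence of zeros on the polydisk\<close>

context
  fixes f :: "complex ^ 'n \<Rightarrow> complex"
  assumes cont: "continuous_on closed_polydisk f" and hol: "holomorphic_several_on f open_polydisk"
begin

lemma continuous_on_mobius_curve:
  assumes a: "a \<in> open_polydisk"
  shows "continuous_on (cball 0 1) (\<lambda>z. f (mobius_curve a z))"
proof (rule continuous_on_compose2[OF cont])
  show "continuous_on (cball 0 1) (mobius_curve a)"
    unfolding mobius_curve_def
    by (intro continuous_intros) (use a mobius_denominator in \<open>auto simp: open_polydisk_def\<close>)
qed (use a mobius_curve_mem in auto)

lemma holomorphic_on_mobius_curve: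
  assumes a: "a \<in> open_polydisk"
  shows "(\<lambda>z. f (mobius_curve a z)) holomorphic_on ball 0 1"
proof (rule holomorphic_several_on_compose[OF hol])
  show "(\<lambda>z. mobius_curve a z $ i) holomorphic_on ball 0 1" for i
    unfolding mobius_curve_def vec_lambda_beta
    by (intro holomorphic_intros) (use a mobius_denominator in \<open>auto simp: open_polydisk_def less_imp_le\<close>)
qed (use a mobius_curve_mem in auto)

lemma polydisk_maximum_modulus:
  assumes bound: "\<And>z. z \<in> torus \<Longrightarrow> cmod (f z) \<le> B" and z: "z \<in> closed_polydisk"
  shows "cmod (f z) \<le> B"
proof -
  have "cmod (f a) \<le> B" if a: "a \<in> open_polydisk" for a
  proof -
    have "cmod (f (mobius_curve a 0)) \<le> B"
    proof (rule maximum_modulus_frontier[where f = "\<lambda>z. f (mobius_curve a z)" and S = "ball 0 1" and \<xi> = 0])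
      show "cmod (f (mobius_curve a z)) \<le> B" if "z \<in> frontier (ball 0 1)" for z
        using that by (intro bound mobius_curve_mem(3) a) simp
    qed (use a holomorphic_on_mobius_curve continuous_on_mobius_curve in auto)
    then show ?thesis by simp
  qed
  \<comment> \<open>The curves reach only the open polydisk; the bound is a closed condition and
    extends by density.\<close>
  then have "f ` open_polydisk \<subseteq> cball 0 B" by auto
  then have "f ` closure open_polydisk \<subseteq> cball 0 B"
    by (intro image_closure_subset) (simp_all add: closure_open_polydisk cont)
  then show ?thesis using z by (auto simp: closure_open_polydisk)
qed

lemma wind_mobius_curve:
  assumes nz: "\<And>z. z \<in> torus \<Longrightarrow> f z \<noteq> 0" and a: "a \<in> open_polydisk"
  shows "wind (\<lambda>z. f (mobius_curve a z)) = wind (\<lambda>z. f (\<chi> i. z))"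
proof -
  \<comment> \<open>Every scaled centre stays in the polydisk, so at each stage of the deformation
    the circle goes into the torus, where \<open>f\<close> has no zeros.\<close>
  have sa: "s *\<^sub>R a \<in> open_polydisk" if "s \<in> {0..1}" for s
    unfolding open_polydisk_def
  proof (intro CollectI allI)
    fix i
    have "cmod ((s *\<^sub>R a) $ i) = s * cmod (a $ i)" using that by simp
    also have "\<dots> \<le> cmod (a $ i)" using that by (simp add: mult_left_le_one_le)
    finally show "cmod ((s *\<^sub>R a) $ i) < 1" using a by (simp add: open_polydisk_def order.strict_trans1)
  qed
  have den: "1 + cnj (s *\<^sub>R a $ i) * z \<noteq> 0" if "s \<in> {0..1}" "z \<in> circle" for s i z
    using sa[OF that(1)] that(2) by (intro mobius_denominator) (auto simp: open_polydisk_def circle_def)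
  have "continuous_on ({0..1} \<times> circle) (\<lambda>x. mobius_curve (fst x *\<^sub>R a) (snd x))"
    unfolding mobius_curve_def
    by (intro continuous_intros) (use den in auto)
  then have "continuous_on ({0..1} \<times> circle) (\<lambda>x. f (mobius_curve (fst x *\<^sub>R a) (snd x)))"
    by (rule continuous_on_compose2[OF cont]) (auto simp: circle_def intro!: mobius_curve_mem(1) sa)
  then have "continuous_on ({0..1} \<times> circle) (\<lambda>(s, z). f (mobius_curve (s *\<^sub>R a) z))"
    by (simp add: case_prod_unfold)
  then have "wind (\<lambda>z. f (mobius_curve (0 *\<^sub>R a) z)) = wind (\<lambda>z. f (mobius_curve (1 *\<^sub>R a) z))"
    by (rule wind_homotopic) (use nz sa mobius_curve_mem(3) in \<open>auto simp: circle_def\<close>)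
  then show ?thesis by simp
qed

lemma nonvanishing_if_wind_diagonal_eq_0:
  assumes nz: "\<And>z. z \<in> torus \<Longrightarrow> f z \<noteq> 0" and wind: "wind (\<lambda>z. f (\<chi> i. z)) = 0"
    and z: "z \<in> closed_polydisk"
  shows "f z \<noteq> 0"
proof -
  have "continuous_on torus (\<lambda>z. cmod (f z))"
    by (intro continuous_intros continuous_on_subset[OF cont torus_subset])
  moreover have "(\<chi> i. 1) \<in> torus" by (simp add: torus_def)
  ultimately obtain z0 where z0: "z0 \<in> torus" "\<And>z. z \<in> torus \<Longrightarrow> cmod (f z0) \<le> cmod (f z)"
    using continuous_attains_inf[OF compact_torus, of "\<lambda>z. cmod (f z)"] by blast
  \<comment> \<open>Positive because the minimum is attained on the compact torus. The same constant
    serves all centres \<open>a\<close>, so that the bound survives the passage to the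
    closure.\<close>
  define \<delta> where "\<delta> = cmod (f z0)"
  have \<delta>: "0 < \<delta>" "\<And>z. z \<in> torus \<Longrightarrow> \<delta> \<le> cmod (f z)"
    using z0 nz by (auto simp: \<delta>_def)
  have "\<delta> \<le> cmod (f a)" if a: "a \<in> open_polydisk" for a
  proof -
    define h where "h z = f (mobius_curve a z)" for z
    have h: "continuous_on (cball 0 1) h" "h holomorphic_on ball 0 1"
      using continuous_on_mobius_curve[OF a] holomorphic_on_mobius_curve[OF a]
      by (simp_all add: h_def[abs_def])
    have circ: "\<delta> \<le> cmod (h z)" if "z \<in> circle" for z
      using that by (simp add: h_def circle_def \<delta>(2) mobius_curve_mem(3)[OF a])
    then have "\<And>z. z \<in> circle \<Longrightarrow> h z \<noteq> 0" using \<delta>(1) by force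
    note zeros = wind_holomorphic_ge_card_zeros[OF h this]
    have "wind h = 0"
      using wind_mobius_curve[OF nz a] wind by (simp add: h_def[abs_def])
    \<comment> \<open>The winding number dominates the number of zeros, so the value 0 leaves room
      for none.\<close>
    with zeros have "card {z \<in> cball 0 1. h z = 0} = 0"
      by linarith
    with zeros have "{z \<in> cball 0 1. h z = 0} = {}"
      using card_0_eq by blast
    then have hnz: "\<And>z. z \<in> cball 0 1 \<Longrightarrow> h z \<noteq> 0" by blast
    have "cmod (inverse (h 0)) \<le> inverse \<delta>"
    proof (rule maximum_modulus_frontier[where f = "\<lambda>z. inverse (h z)" and S = "ball 0 1"])
      show "(\<lambda>z. inverse (h z)) holomorphic_on interior (ball 0 1)"
        using h hnz by (auto intro!: holomorphic_intros)
      show "continuous_on (closure (ball 0 1)) (\<lambda>z. inverse (h z))"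
        using h hnz by (auto intro!: continuous_intros)
      show "cmod (inverse (h z)) \<le> inverse \<delta>" if "z \<in> frontier (ball 0 1)" for z
        using circ[of z] that \<delta>(1) by (simp add: circle_def norm_inverse le_imp_inverse_le)
    qed auto
    then have "\<delta> \<le> cmod (h 0)"
      using \<delta>(1) hnz[of 0] by (simp add: norm_inverse)
    then show ?thesis by (simp add: h_def)
  qed
  then have "f z \<notin> ball 0 \<delta>" if "z \<in> open_polydisk" for z
    using that by (simp add: not_less)
  \<comment> \<open>The complement of an open ball is closed, so the limits that make up the rest of
    the closed polydisk also keep distance \<delta> from 0.\<close>
  then have "f ` open_polydisk \<subseteq> - ball 0 \<delta>" by blast
  then have "f ` closure open_polydisk \<subseteq> - ball 0 \<delta>"
    by (intro image_closure_subset closed_Compl) (simp_all add: closure_open_polydisk cont)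
  then show ?thesis using z \<delta>(1) by (force simp: closure_open_polydisk)
qed

end

section \<open>Banach algebras of continuous functions\<close>

lemma cring_complex: "cring (ring_of_type_algebra :: complex ring)"
  by (rule cring_from_type_algebra)

lemma carrier_ring_of_type_algebra [simp]: "carrier (ring_of_type_algebra :: complex ring) = UNIV"
  and mult_ring_of_type_algebra [simp]: "a \<otimes>\<^bsub>(ring_of_type_algebra :: complex ring)\<^esub> b = a * b"
  and add_ring_of_type_algebra [simp]: "a \<oplus>\<^bsub>(ring_of_type_algebra :: complex ring)\<^esub> b = a + b"
  and one_ring_of_type_algebra [simp]: "\<one>\<^bsub>(ring_of_type_algebra :: complex ring)\<^esub> = 1"
  and zero_ring_of_type_algebra [simp]: "\<zero>\<^bsub>(ring_of_type_algebra :: complex ring)\<^esub> = 0"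
  by (simp_all add: ring_of_type_algebra_def)

lemma function_algebra_sel [simp]:
  "carrier (function_algebra K F) = F \<inter> extensional K"
  "f \<otimes>\<^bsub>function_algebra K F\<^esub> g = (\<lambda>z\<in>K. f z * g z)"
  "\<one>\<^bsub>function_algebra K F\<^esub> = (\<lambda>z\<in>K. 1)"
  "\<zero>\<^bsub>function_algebra K F\<^esub> = (\<lambda>z\<in>K. 0)"
  "f \<oplus>\<^bsub>function_algebra K F\<^esub> g = (\<lambda>z\<in>K. f z + g z)"
  "c \<odot>\<^bsub>function_algebra K F\<^esub> f = (\<lambda>z\<in>K. c * f z)"
  by (simp_all add: function_algebra_def)

text \<open>Closure of \<open>F\<close> is asked for pointwise operations on total functions,
  whereas the operations of the algebra truncate to \<open>K\<close>; closure under
  \<open>restrict\<close> bridges the two.\<close>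

lemma algebra_function_algebra:
  assumes const: "\<And>c. (\<lambda>_. c) \<in> F"
    and add: "\<And>f g. f \<in> F \<Longrightarrow> g \<in> F \<Longrightarrow> (\<lambda>z. f z + g z) \<in> F"
    and mult: "\<And>f g. f \<in> F \<Longrightarrow> g \<in> F \<Longrightarrow> (\<lambda>z. f z * g z) \<in> F"
    and restrict: "\<And>f. f \<in> F \<Longrightarrow> restrict f K \<in> F"
  shows "algebra (ring_of_type_algebra :: complex ring) (function_algebra K F)"
proof -
  let ?A = "function_algebra K F"
  have add_closed: "f \<oplus>\<^bsub>?A\<^esub> g \<in> carrier ?A" and mult_closed: "f \<otimes>\<^bsub>?A\<^esub> g \<in> carrier ?A"
    if "f \<in> carrier ?A" "g \<in> carrier ?A" for f g
    using that restrict[OF add, of f g] restrict[OF mult, of f g] by simp_all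
  have smult_closed: "c \<odot>\<^bsub>?A\<^esub> f \<in> carrier ?A" if "f \<in> carrier ?A" for c f
    using that restrict[OF mult[OF const], of f c] by simp
  have const_closed: "\<one>\<^bsub>?A\<^esub> \<in> carrier ?A" "\<zero>\<^bsub>?A\<^esub> \<in> carrier ?A"
    using restrict[OF const, of 1] restrict[OF const, of 0] by simp_all
  have restrict_id: "(\<lambda>z\<in>K. f z) = f" if "f \<in> carrier ?A" for f
    using that by (simp add: extensional_restrict)
  have group: "abelian_group ?A"
  proof (rule abelian_groupI)
    fix f g h assume f: "f \<in> carrier ?A"
    show "(f \<oplus>\<^bsub>?A\<^esub> g) \<oplus>\<^bsub>?A\<^esub> h = f \<oplus>\<^bsub>?A\<^esub> (g \<oplus>\<^bsub>?A\<^esub> h)"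
      by (simp add: add.assoc cong: restrict_cong)
    show "f \<oplus>\<^bsub>?A\<^esub> g = g \<oplus>\<^bsub>?A\<^esub> f"
      by (simp add: add.commute)
    show "\<zero>\<^bsub>?A\<^esub> \<oplus>\<^bsub>?A\<^esub> f = f"
      using restrict_id[OF f] by (simp cong: restrict_cong)
    \<comment> \<open>The additive inverse is the multiple by -1, which is already known to stay in
      the carrier.\<close>
    have "- 1 \<odot>\<^bsub>?A\<^esub> f \<oplus>\<^bsub>?A\<^esub> f = \<zero>\<^bsub>?A\<^esub>"
      by (simp cong: restrict_cong)
    then show "\<exists>g\<in>carrier ?A. g \<oplus>\<^bsub>?A\<^esub> f = \<zero>\<^bsub>?A\<^esub>"
      using smult_closed[OF f] by blast
  qed (fact add_closed const_closed)+
  have monoid: "comm_monoid ?A"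
  proof (rule comm_monoidI)
    fix f g h assume f: "f \<in> carrier ?A"
    show "(f \<otimes>\<^bsub>?A\<^esub> g) \<otimes>\<^bsub>?A\<^esub> h = f \<otimes>\<^bsub>?A\<^esub> (g \<otimes>\<^bsub>?A\<^esub> h)"
      by (simp add: mult.assoc cong: restrict_cong)
    show "f \<otimes>\<^bsub>?A\<^esub> g = g \<otimes>\<^bsub>?A\<^esub> f"
      by (simp add: mult.commute)
    show "\<one>\<^bsub>?A\<^esub> \<otimes>\<^bsub>?A\<^esub> f = f"
      using restrict_id[OF f] by (simp cong: restrict_cong)
  qed (fact mult_closed const_closed)+
  have "cring ?A"
    by (rule cringI[OF group monoid]) (simp add: distrib_right cong: restrict_cong)
  then show ?thesis
  proof (rule algebraI[OF cring_complex])
    show "\<one>\<^bsub>ring_of_type_algebra\<^esub> \<odot>\<^bsub>?A\<^esub> f = f" if "f \<in> carrier ?A" for f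
      using restrict_id[OF that] by simp
  qed (simp_all add: smult_closed[simplified] distrib_left distrib_right mult.assoc mult.left_commute
      cong: restrict_cong)
qed

text \<open>The difference is defined through an abstractly chosen additive inverse; a concrete
  candidate is recognised by the one equation that determines it.\<close>

lemma (in algebra) minus_unique:
  assumes "x \<in> carrier M" "y \<in> carrier M" "z \<in> carrier M" "z \<oplus>\<^bsub>M\<^esub> y = x"
  shows "x \<ominus>\<^bsub>M\<^esub> y = z"
  using assms(2,3) unfolding assms(4)[symmetric] a_minus_def
  by (simp add: M.a_assoc M.r_neg)

lemma continuous_on_restrict_iff [simp]: "continuous_on K (restrict f K) \<longleftrightarrow> continuous_on K f"
  by (rule continuous_on_cong) auto

lemma carrier_cont_algebra: "f \<in> carrier (cont_algebra K) \<longleftrightarrow> continuous_on K f \<and> f \<in> extensional K"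
  by (simp add: cont_algebra_def)

lemma algebra_cont_algebra: "algebra (ring_of_type_algebra :: complex ring) (cont_algebra K)"
  unfolding cont_algebra_def
  by (rule algebra_function_algebra) (simp_all add: continuous_on_add continuous_on_mult)

lemma minus_cont_algebra:
  assumes "f \<in> carrier (cont_algebra K)" "g \<in> carrier (cont_algebra K)"
  shows "f \<ominus>\<^bsub>cont_algebra K\<^esub> g = (\<lambda>z\<in>K. f z - g z)"
proof (rule algebra.minus_unique[OF algebra_cont_algebra assms])
  show "(\<lambda>z\<in>K. f z - g z) \<in> carrier (cont_algebra K)"
    using assms by (simp add: carrier_cont_algebra continuous_on_diff)
  show "(\<lambda>z\<in>K. f z - g z) \<oplus>\<^bsub>cont_algebra K\<^esub> g = f"
    using assms by (simp add: cont_algebra_def extensional_restrict cong: restrict_cong)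
qed

text \<open>The Banach axioms without completeness. Working with completeness presupposes that
  \<open>norm_dist\<close> is a metric, which has to be derived from the other axioms first.\<close>

locale complex_comm_normed_algebra =
  algebra "ring_of_type_algebra :: complex ring" A
    for A :: "(complex, 'a) module" (structure) and N :: "'a \<Rightarrow> real" +
  assumes norm_nonneg: "x \<in> carrier A \<Longrightarrow> 0 \<le> N x"
    and norm_eq_zero: "x \<in> carrier A \<Longrightarrow> N x = 0 \<longleftrightarrow> x = \<zero>\<^bsub>A\<^esub>"
    and norm_triangle: "x \<in> carrier A \<Longrightarrow> y \<in> carrier A \<Longrightarrow> N (x \<oplus>\<^bsub>A\<^esub> y) \<le> N x + N y"
    and norm_smult: "x \<in> carrier A \<Longrightarrow> N (c \<odot>\<^bsub>A\<^esub> x) = cmod c * N x"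
    and norm_mult: "x \<in> carrier A \<Longrightarrow> y \<in> carrier A \<Longrightarrow> N (x \<otimes>\<^bsub>A\<^esub> y) \<le> N x * N y"
    and norm_one: "N \<one>\<^bsub>A\<^esub> = 1"
begin

text \<open>Makes \<open>norm_dist\<close> symmetric; the negative is first recognised as the
  multiple by -1.\<close>

lemma norm_uminus:
  assumes x: "x \<in> carrier A"
  shows "N (\<ominus>\<^bsub>A\<^esub> x) = N x"
proof -
  have "(- 1 :: complex) \<odot>\<^bsub>A\<^esub> x \<oplus>\<^bsub>A\<^esub> x = (- 1 + 1 :: complex) \<odot>\<^bsub>A\<^esub> x"
    using smult_l_distr[of "- 1" 1 x] smult_one[OF x] x by simp
  also have "\<dots> = \<zero>\<^bsub>A\<^esub>"
    using smult_l_null[OF x] by simp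
  finally have "\<ominus>\<^bsub>A\<^esub> x = (- 1 :: complex) \<odot>\<^bsub>A\<^esub> x"
    using x by (intro M.minus_equality) simp_all
  then show ?thesis using norm_smult[OF x, of "- 1"] by simp
qed

lemma Metric_space_norm_dist: "Metric_space (carrier A) (norm_dist A N)"
proof
  show "0 \<le> norm_dist A N x y" for x y
    by (simp add: norm_dist_def norm_nonneg)
  show "norm_dist A N x y = norm_dist A N y x" for x y
  proof (cases "x \<in> carrier A \<and> y \<in> carrier A")
    case True
    then have "\<ominus>\<^bsub>A\<^esub> (x \<ominus>\<^bsub>A\<^esub> y) = y \<ominus>\<^bsub>A\<^esub> x"
      by (simp add: a_minus_def M.minus_add M.a_comm)
    then show ?thesis
      using True norm_uminus[of "x \<ominus>\<^bsub>A\<^esub> y"] by (simp add: norm_dist_def)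
  qed (auto simp: norm_dist_def)
  show "norm_dist A N x y = 0 \<longleftrightarrow> x = y" if "x \<in> carrier A" "y \<in> carrier A" for x y
    using that by (simp add: norm_dist_def norm_eq_zero)
  show "norm_dist A N x z \<le> norm_dist A N x y + norm_dist A N y z"
    if "x \<in> carrier A" "y \<in> carrier A" "z \<in> carrier A" for x y z
  proof -
    have "(x \<ominus>\<^bsub>A\<^esub> y) \<oplus>\<^bsub>A\<^esub> (y \<ominus>\<^bsub>A\<^esub> z) = x \<ominus>\<^bsub>A\<^esub> z"
      using that by (simp add: a_minus_def M.a_assoc M.r_neg2 M.r_neg1)
    then show ?thesis
      using that norm_triangle[of "x \<ominus>\<^bsub>A\<^esub> y" "y \<ominus>\<^bsub>A\<^esub> z"] by (simp add: norm_dist_def)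
  qed
qed

lemma banach_algebraI:
  assumes "Metric_space.mcomplete (carrier A) (norm_dist A N)"
  shows "complex_comm_banach_algebra A N"
  by unfold_locales
    (use assms norm_nonneg norm_eq_zero norm_triangle norm_smult norm_mult norm_one in auto)

end

lemma (in complex_comm_banach_algebra) normed_algebra: "complex_comm_normed_algebra A N"
  by unfold_locales
    (use norm_nonneg norm_eq_zero norm_triangle norm_smult norm_mult norm_one in auto)

section \<open>The supremum norm on a nonempty compact set\<close>

context
  fixes K :: "'a::topological_space set"
  assumes K: "compact K" "K \<noteq> {}"
begin

lemma bdd_above_cmod:
  assumes "continuous_on K f"
  shows "bdd_above ((\<lambda>z. cmod (f z)) ` K)"
  using assms K by (intro bounded_imp_bdd_above compact_imp_bounded compact_continuous_image continuous_intros)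

lemma cmod_le_sup_norm:
  assumes "continuous_on K f" "z \<in> K"
  shows "cmod (f z) \<le> sup_norm K f"
  unfolding sup_norm_def by (rule cSUP_upper[OF assms(2) bdd_above_cmod[OF assms(1)]])

lemma sup_norm_le:
  assumes "\<And>z. z \<in> K \<Longrightarrow> cmod (f z) \<le> B"
  shows "sup_norm K f \<le> B"
  unfolding sup_norm_def by (rule cSUP_least[OF K(2) assms])

lemma sup_norm_nonneg:
  assumes "continuous_on K f"
  shows "0 \<le> sup_norm K f"
proof -
  obtain z where "z \<in> K" using K(2) by blast
  from cmod_le_sup_norm[OF assms this] norm_ge_zero[of "f z"] show ?thesis by linarith
qed

lemma sup_norm_smult:
  assumes "continuous_on K f"
  shows "sup_norm K (\<lambda>z\<in>K. c * f z) = cmod c * sup_norm K f"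
proof (rule antisym)
  show "sup_norm K (\<lambda>z\<in>K. c * f z) \<le> cmod c * sup_norm K f"
    by (rule sup_norm_le) (simp add: norm_mult mult_left_mono cmod_le_sup_norm[OF assms])
  show "cmod c * sup_norm K f \<le> sup_norm K (\<lambda>z\<in>K. c * f z)"
  proof (cases "c = 0")
    case True
    then show ?thesis
      by (simp add: sup_norm_nonneg)
  next
    case False
    have "sup_norm K f \<le> sup_norm K (\<lambda>z\<in>K. c * f z) / cmod c"
    proof (rule sup_norm_le)
      fix z assume z: "z \<in> K"
      have "cmod ((\<lambda>z\<in>K. c * f z) z) \<le> sup_norm K (\<lambda>z\<in>K. c * f z)"
        by (rule cmod_le_sup_norm) (use assms z in \<open>auto intro!: continuous_intros\<close>)
      with z False show "cmod (f z) \<le> sup_norm K (\<lambda>z\<in>K. c * f z) / cmod c"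
        by (simp add: norm_mult field_simps)
    qed
    with False show ?thesis by (simp add: field_simps)
  qed
qed

lemma normed_cont_algebra: "complex_comm_normed_algebra (cont_algebra K) (sup_norm K)"
proof (intro complex_comm_normed_algebra.intro algebra_cont_algebra complex_comm_normed_algebra_axioms.intro)
  fix f assume "f \<in> carrier (cont_algebra K)"
  then have f: "continuous_on K f" and ext: "f \<in> extensional K"
    by (simp_all add: cont_algebra_def)
  show "0 \<le> sup_norm K f" by (rule sup_norm_nonneg[OF f])
  show "sup_norm K f = 0 \<longleftrightarrow> f = \<zero>\<^bsub>cont_algebra K\<^esub>"
  proof
    assume 0: "sup_norm K f = 0"
    show "f = \<zero>\<^bsub>cont_algebra K\<^esub>"
    proof (rule extensionalityI[OF ext])
      show "f z = \<zero>\<^bsub>cont_algebra K\<^esub> z" if "z \<in> K" for z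
        using cmod_le_sup_norm[OF f that] 0 that by (simp add: cont_algebra_def)
    qed (simp add: cont_algebra_def)
  next
    assume "f = \<zero>\<^bsub>cont_algebra K\<^esub>"
    then have "f z = 0" if "z \<in> K" for z using that by (simp add: cont_algebra_def)
    then have "sup_norm K f \<le> 0" by (intro sup_norm_le) simp
    with sup_norm_nonneg[OF f] show "sup_norm K f = 0" by simp
  qed
  show "sup_norm K (c \<odot>\<^bsub>cont_algebra K\<^esub> f) = cmod c * sup_norm K f" for c
    using sup_norm_smult[OF f] by (simp add: cont_algebra_def)
  fix g assume "g \<in> carrier (cont_algebra K)"
  then have g: "continuous_on K g"
    by (simp add: cont_algebra_def)
  show "sup_norm K (f \<oplus>\<^bsub>cont_algebra K\<^esub> g) \<le> sup_norm K f + sup_norm K g"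
  proof (rule sup_norm_le)
    fix z assume z: "z \<in> K"
    show "cmod ((f \<oplus>\<^bsub>cont_algebra K\<^esub> g) z) \<le> sup_norm K f + sup_norm K g"
      using z norm_triangle_ineq[of "f z" "g z"] cmod_le_sup_norm[OF f z] cmod_le_sup_norm[OF g z]
      by (simp add: cont_algebra_def)
  qed
  show "sup_norm K (f \<otimes>\<^bsub>cont_algebra K\<^esub> g) \<le> sup_norm K f * sup_norm K g"
  proof (rule sup_norm_le)
    fix z assume z: "z \<in> K"
    show "cmod ((f \<otimes>\<^bsub>cont_algebra K\<^esub> g) z) \<le> sup_norm K f * sup_norm K g"
      using z by (auto simp: cont_algebra_def norm_mult
          intro!: mult_mono cmod_le_sup_norm f g sup_norm_nonneg)
  qed
next
  have "sup_norm K (\<lambda>z\<in>K. 1) = (SUP z\<in>K. 1)"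
    unfolding sup_norm_def by (rule SUP_cong) auto
  then show "sup_norm K \<one>\<^bsub>cont_algebra K\<^esub> = 1"
    using K(2) by (simp add: cont_algebra_def)
qed

text \<open>Cauchy in the supremum norm means uniformly Cauchy on \<open>K\<close>; the uniform
  limit is continuous, and truncating it outside \<open>K\<close> puts it into the carrier.\<close>

lemma banach_cont_algebra: "complex_comm_banach_algebra (cont_algebra K) (sup_norm K)"
proof (rule complex_comm_normed_algebra.banach_algebraI[OF normed_cont_algebra])
  interpret Metric_space "carrier (cont_algebra K)" "norm_dist (cont_algebra K) (sup_norm K)"
    by (rule complex_comm_normed_algebra.Metric_space_norm_dist[OF normed_cont_algebra])
  have dist: "norm_dist (cont_algebra K) (sup_norm K) f g = sup_norm K (\<lambda>z\<in>K. f z - g z)"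
    if "f \<in> carrier (cont_algebra K)" "g \<in> carrier (cont_algebra K)" for f g
    using that by (simp add: norm_dist_def minus_cont_algebra)
  show mcomplete
    unfolding mcomplete_def
  proof (intro allI impI)
    fix \<sigma> assume cauchy: "MCauchy \<sigma>"
    then have \<sigma>: "\<sigma> n \<in> carrier (cont_algebra K)" for n
      by (auto simp: MCauchy_def)
    have unif: "\<forall>e>0. \<exists>M. \<forall>m n z. M \<le> m \<and> M \<le> n \<and> z \<in> K \<longrightarrow> dist (\<sigma> m z) (\<sigma> n z) < e"
    proof (intro allI impI)
      fix e :: real assume "0 < e"
      then obtain M where M: "\<And>m n. M \<le> m \<Longrightarrow> M \<le> n \<Longrightarrow>
          norm_dist (cont_algebra K) (sup_norm K) (\<sigma> m) (\<sigma> n) < e"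
        using cauchy unfolding MCauchy_def by meson
      have "dist (\<sigma> m z) (\<sigma> n z) < e" if "M \<le> m" "M \<le> n" "z \<in> K" for m n z
      proof -
        have "cmod ((\<lambda>z\<in>K. \<sigma> m z - \<sigma> n z) z) \<le> sup_norm K (\<lambda>z\<in>K. \<sigma> m z - \<sigma> n z)"
          by (rule cmod_le_sup_norm) (use \<sigma> that in \<open>simp_all add: carrier_cont_algebra continuous_on_diff\<close>)
        then show ?thesis
          using M[OF that(1,2)] \<sigma> that(3) by (simp add: dist dist_norm)
      qed
      then show "\<exists>M. \<forall>m n z. M \<le> m \<and> M \<le> n \<and> z \<in> K \<longrightarrow> dist (\<sigma> m z) (\<sigma> n z) < e"
        by blast
    qed
    then obtain l where l: "\<forall>e>0. \<exists>M. \<forall>n z. M \<le> n \<and> z \<in> K \<longrightarrow> dist (\<sigma> n z) (l z) < e"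
      using uniformly_convergent_eq_cauchy[of "\<lambda>z. z \<in> K" \<sigma>] by blast
    have "uniform_limit K \<sigma> l sequentially"
      unfolding uniform_limit_sequentially_iff using l by blast
    then have "continuous_on K l"
      by (rule uniform_limit_theorem[rotated]) (use \<sigma> in \<open>auto simp: carrier_cont_algebra\<close>)
    then have lim: "restrict l K \<in> carrier (cont_algebra K)"
      by (simp add: carrier_cont_algebra)
    have "limitin mtopology \<sigma> (restrict l K) sequentially"
      unfolding limit_metric_sequentially
    proof (intro conjI allI impI lim)
      fix e :: real assume e: "0 < e"
      \<comment> \<open>Half of \<open>e\<close>, because the supremum of values below
        \<open>e / 2\<close> is only known to be at most \<open>e / 2\<close>.\<close>
      then obtain M where M: "\<And>n z. M \<le> n \<Longrightarrow> z \<in> K \<Longrightarrow> dist (\<sigma> n z) (l z) < e / 2"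
        using l half_gt_zero by metis
      have "norm_dist (cont_algebra K) (sup_norm K) (\<sigma> n) (restrict l K) < e" if "M \<le> n" for n
      proof -
        have "sup_norm K (\<lambda>z\<in>K. \<sigma> n z - restrict l K z) \<le> e / 2"
          by (rule sup_norm_le) (use M[OF that] in \<open>simp add: dist_norm less_imp_le\<close>)
        then show ?thesis using e by (simp add: dist[OF \<sigma> lim])
      qed
      then show "\<exists>M. \<forall>n\<ge>M. \<sigma> n \<in> carrier (cont_algebra K) \<and>
          norm_dist (cont_algebra K) (sup_norm K) (\<sigma> n) (restrict l K) < e"
        using \<sigma> by blast
    qed
    then show "\<exists>x. limitin mtopology \<sigma> x sequentially" by blast
  qed
qed

end

section \<open>Products of Banach algebras\<close>

lemma product_algebra_sel [simp]:
  "carrier (product_algebra A B) = carrier A \<times> carrier B"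
  "x \<otimes>\<^bsub>product_algebra A B\<^esub> y = (fst x \<otimes>\<^bsub>A\<^esub> fst y, snd x \<otimes>\<^bsub>B\<^esub> snd y)"
  "\<one>\<^bsub>product_algebra A B\<^esub> = (\<one>\<^bsub>A\<^esub>, \<one>\<^bsub>B\<^esub>)"
  "\<zero>\<^bsub>product_algebra A B\<^esub> = (\<zero>\<^bsub>A\<^esub>, \<zero>\<^bsub>B\<^esub>)"
  "x \<oplus>\<^bsub>product_algebra A B\<^esub> y = (fst x \<oplus>\<^bsub>A\<^esub> fst y, snd x \<oplus>\<^bsub>B\<^esub> snd y)"
  "c \<odot>\<^bsub>product_algebra A B\<^esub> x = (c \<odot>\<^bsub>A\<^esub> fst x, c \<odot>\<^bsub>B\<^esub> snd x)"
  by (simp_all add: product_algebra_def case_prod_unfold)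

lemma algebra_product_algebra:
  assumes "algebra R A" "algebra R B"
  shows "algebra R (product_algebra A B)"
proof -
  interpret A: algebra R A by fact
  interpret B: algebra R B by fact
  have group: "abelian_group (product_algebra A B)"
  proof (rule abelian_groupI)
    fix x assume "x \<in> carrier (product_algebra A B)"
    then have "(\<ominus>\<^bsub>A\<^esub> fst x, \<ominus>\<^bsub>B\<^esub> snd x) \<in> carrier (product_algebra A B)"
      and "(\<ominus>\<^bsub>A\<^esub> fst x, \<ominus>\<^bsub>B\<^esub> snd x) \<oplus>\<^bsub>product_algebra A B\<^esub> x = \<zero>\<^bsub>product_algebra A B\<^esub>"
      by (auto simp: A.M.l_neg B.M.l_neg)
    then show "\<exists>y\<in>carrier (product_algebra A B). y \<oplus>\<^bsub>product_algebra A B\<^esub> x = \<zero>\<^bsub>product_algebra A B\<^esub>"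
      by blast
  qed (auto simp: A.M.a_ac B.M.a_ac)
  have monoid: "comm_monoid (product_algebra A B)"
    by (rule comm_monoidI) (auto simp: A.m_ac B.m_ac)
  have "cring (product_algebra A B)"
    by (rule cringI[OF group monoid]) (auto simp: A.l_distr B.l_distr)
  then show ?thesis
    by (rule algebraI[OF A.R_cring])
      (auto simp: A.smult_l_distr B.smult_l_distr A.smult_r_distr B.smult_r_distr
        A.smult_assoc1 B.smult_assoc1 A.smult_assoc2 B.smult_assoc2)
qed

lemma minus_product_algebra:
  assumes "algebra R A" "algebra R B"
    and "x \<in> carrier (product_algebra A B)" "y \<in> carrier (product_algebra A B)"
  shows "x \<ominus>\<^bsub>product_algebra A B\<^esub> y = (fst x \<ominus>\<^bsub>A\<^esub> fst y, snd x \<ominus>\<^bsub>B\<^esub> snd y)"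
proof -
  interpret A: algebra R A by fact
  interpret B: algebra R B by fact
  show ?thesis
    by (rule algebra.minus_unique[OF algebra_product_algebra[OF assms(1,2)] assms(3,4)])
      (use assms(3,4) in \<open>auto simp: a_minus_def A.M.a_assoc B.M.a_assoc A.M.l_neg B.M.l_neg\<close>)
qed

lemma normed_product_algebra:
  assumes "complex_comm_normed_algebra A N\<^sub>1" "complex_comm_normed_algebra B N\<^sub>2"
  shows "complex_comm_normed_algebra (product_algebra A B) (\<lambda>(a, b). max (N\<^sub>1 a) (N\<^sub>2 b))"
proof -
  interpret A: complex_comm_normed_algebra A N\<^sub>1 by fact
  interpret B: complex_comm_normed_algebra B N\<^sub>2 by fact
  show ?thesis
  proof (intro complex_comm_normed_algebra.intro complex_comm_normed_algebra_axioms.intro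
      algebra_product_algebra A.algebra_axioms B.algebra_axioms)
    fix x assume "x \<in> carrier (product_algebra A B)"
    then obtain a b where x: "x = (a, b)" "a \<in> carrier A" "b \<in> carrier B" by auto
    note ab = A.norm_nonneg[OF x(2)] B.norm_nonneg[OF x(3)]
    show "0 \<le> (case x of (a, b) \<Rightarrow> max (N\<^sub>1 a) (N\<^sub>2 b))"
      using ab by (simp add: x)
    show "(case x of (a, b) \<Rightarrow> max (N\<^sub>1 a) (N\<^sub>2 b)) = 0 \<longleftrightarrow> x = \<zero>\<^bsub>product_algebra A B\<^esub>"
      using ab A.norm_eq_zero[OF x(2)] B.norm_eq_zero[OF x(3)] by (auto simp: x(1) max_def)
    show "(case c \<odot>\<^bsub>product_algebra A B\<^esub> x of (a, b) \<Rightarrow> max (N\<^sub>1 a) (N\<^sub>2 b)) =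
        cmod c * (case x of (a, b) \<Rightarrow> max (N\<^sub>1 a) (N\<^sub>2 b))" for c
      by (simp add: x A.norm_smult B.norm_smult max_mult_distrib_left)
    fix y assume "y \<in> carrier (product_algebra A B)"
    then obtain c d where y: "y = (c, d)" "c \<in> carrier A" "d \<in> carrier B" by auto
    note cd = A.norm_nonneg[OF y(2)] B.norm_nonneg[OF y(3)]
    show "(case x \<oplus>\<^bsub>product_algebra A B\<^esub> y of (a, b) \<Rightarrow> max (N\<^sub>1 a) (N\<^sub>2 b)) \<le>
        (case x of (a, b) \<Rightarrow> max (N\<^sub>1 a) (N\<^sub>2 b)) + (case y of (a, b) \<Rightarrow> max (N\<^sub>1 a) (N\<^sub>2 b))"
      using A.norm_triangle[OF x(2) y(2)] B.norm_triangle[OF x(3) y(3)]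
      by (auto simp: x(1) y(1) max_def)
    have "N\<^sub>1 a * N\<^sub>1 c \<le> max (N\<^sub>1 a) (N\<^sub>2 b) * max (N\<^sub>1 c) (N\<^sub>2 d)"
      and "N\<^sub>2 b * N\<^sub>2 d \<le> max (N\<^sub>1 a) (N\<^sub>2 b) * max (N\<^sub>1 c) (N\<^sub>2 d)"
      using ab cd by (intro mult_mono; simp)+
    then show "(case x \<otimes>\<^bsub>product_algebra A B\<^esub> y of (a, b) \<Rightarrow> max (N\<^sub>1 a) (N\<^sub>2 b)) \<le>
        (case x of (a, b) \<Rightarrow> max (N\<^sub>1 a) (N\<^sub>2 b)) * (case y of (a, b) \<Rightarrow> max (N\<^sub>1 a) (N\<^sub>2 b))"
      using A.norm_mult[OF x(2) y(2)] B.norm_mult[OF x(3) y(3)] by (simp add: x(1) y(1))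
  qed (simp add: A.norm_one B.norm_one)
qed

lemma norm_dist_product_algebra:
  assumes "algebra R A" "algebra R B" "a \<in> carrier A" "b \<in> carrier B" "c \<in> carrier A" "d \<in> carrier B"
  shows "norm_dist (product_algebra A B) (\<lambda>(a, b). max (N\<^sub>1 a) (N\<^sub>2 b)) (a, b) (c, d) =
    max (norm_dist A N\<^sub>1 a c) (norm_dist B N\<^sub>2 b d)"
  using assms by (simp add: norm_dist_def minus_product_algebra[OF assms(1,2)])

text \<open>A maximum of two distances is below \<open>e\<close> exactly if both are, so Cauchy
  sequences and limits split into components.\<close>

lemma banach_product_algebra:
  assumes "complex_comm_banach_algebra A N\<^sub>1" "complex_comm_banach_algebra B N\<^sub>2"
  shows "complex_comm_banach_algebra (product_algebra A B) (\<lambda>(a, b). max (N\<^sub>1 a) (N\<^sub>2 b))"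
proof -
  interpret A: complex_comm_banach_algebra A N\<^sub>1 by fact
  interpret B: complex_comm_banach_algebra B N\<^sub>2 by fact
  let ?P = "product_algebra A B" and ?N = "\<lambda>(a, b). max (N\<^sub>1 a) (N\<^sub>2 b)"
  have normed: "complex_comm_normed_algebra ?P ?N"
    by (rule normed_product_algebra[OF A.normed_algebra B.normed_algebra])
  interpret MA: Metric_space "carrier A" "norm_dist A N\<^sub>1"
    by (rule complex_comm_normed_algebra.Metric_space_norm_dist[OF A.normed_algebra])
  interpret MB: Metric_space "carrier B" "norm_dist B N\<^sub>2"
    by (rule complex_comm_normed_algebra.Metric_space_norm_dist[OF B.normed_algebra])
  interpret MP: Metric_space "carrier ?P" "norm_dist ?P ?N"
    by (rule complex_comm_normed_algebra.Metric_space_norm_dist[OF normed])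
  have dist: "norm_dist ?P ?N x y =
      max (norm_dist A N\<^sub>1 (fst x) (fst y)) (norm_dist B N\<^sub>2 (snd x) (snd y))"
    if "x \<in> carrier ?P" "y \<in> carrier ?P" for x y
    using that norm_dist_product_algebra[OF A.algebra_axioms B.algebra_axioms,
        of "fst x" "snd x" "fst y" "snd y" N\<^sub>1 N\<^sub>2]
    by auto
  have "MP.mcomplete"
    unfolding MP.mcomplete_def
  proof (intro allI impI)
    fix \<sigma> assume \<sigma>: "MP.MCauchy \<sigma>"
    have range: "range \<sigma> \<subseteq> carrier ?P"
      and cauchy: "\<forall>e>0. \<exists>M. \<forall>m n. M \<le> m \<longrightarrow> M \<le> n \<longrightarrow> norm_dist ?P ?N (\<sigma> m) (\<sigma> n) < e"
      using \<sigma> unfolding MP.MCauchy_def by (rule conjunct1, rule conjunct2)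
    have carr: "\<sigma> n \<in> carrier ?P" for n
      using range by (rule range_subsetD)
    then have carr': "fst (\<sigma> n) \<in> carrier A" "snd (\<sigma> n) \<in> carrier B" for n
      by (auto simp: mem_Times_iff)
    note cauchy = cauchy[unfolded dist[OF carr carr] max_less_iff_conj]
    have "MA.MCauchy (\<lambda>n. fst (\<sigma> n))"
      unfolding MA.MCauchy_def
    proof (intro conjI allI impI)
      show "\<exists>M. \<forall>m n. M \<le> m \<longrightarrow> M \<le> n \<longrightarrow> norm_dist A N\<^sub>1 (fst (\<sigma> m)) (fst (\<sigma> n)) < e"
        if "0 < e" for e
        using cauchy that by meson
    qed (use carr' in blast)
    from A.complete[unfolded MA.mcomplete_def, rule_format, OF this]
    obtain a where "limitin MA.mtopology (\<lambda>n. fst (\<sigma> n)) a sequentially" ..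
    note a = this[unfolded MA.limitin_metric]
    have "MB.MCauchy (\<lambda>n. snd (\<sigma> n))"
      unfolding MB.MCauchy_def
    proof (intro conjI allI impI)
      show "\<exists>M. \<forall>m n. M \<le> m \<longrightarrow> M \<le> n \<longrightarrow> norm_dist B N\<^sub>2 (snd (\<sigma> m)) (snd (\<sigma> n)) < e"
        if "0 < e" for e
        using cauchy that by meson
    qed (use carr' in blast)
    from B.complete[unfolded MB.mcomplete_def, rule_format, OF this]
    obtain b where "limitin MB.mtopology (\<lambda>n. snd (\<sigma> n)) b sequentially" ..
    note b = this[unfolded MB.limitin_metric]
    have ab: "(a, b) \<in> carrier ?P"
      using conjunct1[OF a] conjunct1[OF b] by simp
    have "limitin MP.mtopology \<sigma> (a, b) sequentially"
      unfolding MP.limitin_metric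
    proof (intro conjI allI impI ab)
      fix e :: real assume e: "0 < e"
      have "\<forall>\<^sub>F n in sequentially. norm_dist A N\<^sub>1 (fst (\<sigma> n)) a < e"
        using conjunct2[OF a] e by (auto dest!: spec[of _ e] simp: eventually_conj_iff)
      moreover have "\<forall>\<^sub>F n in sequentially. norm_dist B N\<^sub>2 (snd (\<sigma> n)) b < e"
        using conjunct2[OF b] e by (auto dest!: spec[of _ e] simp: eventually_conj_iff)
      ultimately show "\<forall>\<^sub>F n in sequentially. \<sigma> n \<in> carrier ?P \<and> norm_dist ?P ?N (\<sigma> n) (a, b) < e"
        by eventually_elim (simp only: dist[OF carr ab] carr fst_conv snd_conv max_less_iff_conj simp_thms)
    qed
    then show "\<exists>x. limitin MP.mtopology \<sigma> x sequentially" by blast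
  qed
  then show ?thesis
    by (rule complex_comm_normed_algebra.banach_algebraI[OF normed])
qed

text \<open>An ideal strictly above the kernel contains some \<open>x\<close> with
  \<open>h x \<noteq> 0\<close>. Rescaled to \<open>u\<close> with \<open>h u = 1\<close>, it leaves
  \<open>1 - u\<close> in the kernel, so the ideal contains 1.\<close>

lemma maximalideal_character_kernel:
  fixes A :: "(complex, 'a) module"
  assumes alg: "algebra (ring_of_type_algebra :: complex ring) A"
    and h: "h \<in> ring_hom A (ring_of_type_algebra :: complex ring)"
    and smult: "\<And>c x. x \<in> carrier A \<Longrightarrow> h (c \<odot>\<^bsub>A\<^esub> x) = c * h x"
  shows "maximalideal {x \<in> carrier A. h x = 0} A"
proof -
  interpret algebra "ring_of_type_algebra :: complex ring" A by fact
  have hom: "ring_hom_ring A (ring_of_type_algebra :: complex ring) h"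
    by (rule ring_hom_ringI2[OF cring.axioms(1)[OF M_cring] cring.axioms(1)[OF R_cring] h])
  have h_add: "h (x \<oplus>\<^bsub>A\<^esub> y) = h x + h y" if "x \<in> carrier A" "y \<in> carrier A" for x y
    using ring_hom_add[OF h that] by simp
  have h_one: "h \<one>\<^bsub>A\<^esub> = 1"
    using ring_hom_one[OF h] by simp
  have kernel: "a_kernel A (ring_of_type_algebra :: complex ring) h = {x \<in> carrier A. h x = 0}"
    unfolding a_kernel_def' by simp
  show ?thesis
  proof (rule maximalidealI)
    show "ideal {x \<in> carrier A. h x = 0} A"
      using ring_hom_ring.kernel_is_ideal[OF hom] by (simp only: kernel)
    have "h \<one>\<^bsub>A\<^esub> \<noteq> 0" using h_one by simp
    then show "carrier A \<noteq> {x \<in> carrier A. h x = 0}"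
      using one_closed by blast
    fix J assume J: "ideal J A" "{x \<in> carrier A. h x = 0} \<subseteq> J" "J \<subseteq> carrier A"
    interpret J: ideal J A by fact
    show "J = {x \<in> carrier A. h x = 0} \<or> J = carrier A"
    proof (rule disjCI)
      assume "J \<noteq> carrier A"
      have "h x = 0" if x: "x \<in> J" for x
      proof (rule ccontr)
        assume nz: "h x \<noteq> 0"
        have xA: "x \<in> carrier A" using x J(3) by blast
        define u where "u = inverse (h x) \<odot>\<^bsub>A\<^esub> x"
        have u: "u \<in> carrier A" "h u = 1"
          using xA nz by (simp_all add: u_def smult)
        \<comment> \<open>Ideals absorb ring multiples, so the scalar multiple is rewritten as a
          product with a multiple of 1.\<close>
        have "u = (inverse (h x) \<odot>\<^bsub>A\<^esub> \<one>\<^bsub>A\<^esub>) \<otimes>\<^bsub>A\<^esub> x"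
          using xA by (simp add: u_def smult_assoc2)
        then have uJ: "u \<in> J"
          using x by (simp add: J.I_l_closed)
        have "\<one>\<^bsub>A\<^esub> \<ominus>\<^bsub>A\<^esub> u \<in> {x \<in> carrier A. h x = 0}"
        proof -
          have "h (\<one>\<^bsub>A\<^esub> \<ominus>\<^bsub>A\<^esub> u \<oplus>\<^bsub>A\<^esub> u) = h (\<one>\<^bsub>A\<^esub> \<ominus>\<^bsub>A\<^esub> u) + h u"
            using h_add[of "\<one>\<^bsub>A\<^esub> \<ominus>\<^bsub>A\<^esub> u" u] u by simp
          moreover have "\<one>\<^bsub>A\<^esub> \<ominus>\<^bsub>A\<^esub> u \<oplus>\<^bsub>A\<^esub> u = \<one>\<^bsub>A\<^esub>"
            using u by (simp add: a_minus_def M.a_assoc M.l_neg)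
          ultimately show ?thesis using u h_one by simp
        qed
        then have "\<one>\<^bsub>A\<^esub> \<ominus>\<^bsub>A\<^esub> u \<in> J" using J(2) by blast
        then have "\<one>\<^bsub>A\<^esub> \<ominus>\<^bsub>A\<^esub> u \<oplus>\<^bsub>A\<^esub> u \<in> J" using uJ by (rule J.a_closed)
        moreover have "\<one>\<^bsub>A\<^esub> \<ominus>\<^bsub>A\<^esub> u \<oplus>\<^bsub>A\<^esub> u = \<one>\<^bsub>A\<^esub>"
          using u by (simp add: a_minus_def M.a_assoc M.l_neg)
        ultimately have "J = carrier A" using J.one_imp_carrier by simp
        with \<open>J \<noteq> carrier A\<close> show False by contradiction
      qed
      then show "J = {x \<in> carrier A. h x = 0}" using J(2,3) by blast
    qed
  qed
qed

text \<open>The radical lies in every maximal ideal, in particular in the kernel of every character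
  in \<Phi>.\<close>

lemma comm_semisimple_if_characters_separate:
  fixes A :: "(complex, 'a) module"
  assumes alg: "algebra (ring_of_type_algebra :: complex ring) A"
    and \<Phi>: "\<Phi> \<subseteq> ring_hom A (ring_of_type_algebra :: complex ring)" "\<Phi> \<noteq> {}"
    and smult: "\<And>h c x. h \<in> \<Phi> \<Longrightarrow> x \<in> carrier A \<Longrightarrow> h (c \<odot>\<^bsub>A\<^esub> x) = c * h x"
    and separate: "\<And>x. x \<in> carrier A \<Longrightarrow> (\<And>h. h \<in> \<Phi> \<Longrightarrow> h x = 0) \<Longrightarrow> x = \<zero>\<^bsub>A\<^esub>"
  shows "comm_semisimple A"
  unfolding comm_semisimple_def
proof (intro equalityI subsetI)
  fix x assume x: "x \<in> \<Inter> {I. maximalideal I A}"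
  have ker: "x \<in> {x \<in> carrier A. h x = 0}" if "h \<in> \<Phi>" for h
    using x maximalideal_character_kernel[OF alg, of h] \<Phi>(1) smult[OF that] that by blast
  \<comment> \<open>Nonemptiness of \<Phi> enters here: membership in some kernel places
    \<open>x\<close> in the carrier.\<close>
  with \<Phi>(2) have "x = \<zero>\<^bsub>A\<^esub>" by (intro separate) auto
  then show "x \<in> {\<zero>\<^bsub>A\<^esub>}" by simp
next
  fix x assume "x \<in> {\<zero>\<^bsub>A\<^esub>}"
  then show "x \<in> \<Inter> {I. maximalideal I A}"
    by (auto simp: maximalideal_def ideal_def additive_subgroup.zero_closed)
qed

section \<open>The polydisk algebra\<close>

lemma holomorphic_several_on_const: "holomorphic_several_on (\<lambda>_. c) U"
  unfolding holomorphic_several_on_def by (auto intro!: exI[of _ "\<lambda>_. 0"])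

lemma holomorphic_several_on_add:
  assumes "holomorphic_several_on f U" "holomorphic_several_on g U"
  shows "holomorphic_several_on (\<lambda>z. f z + g z) U"
  unfolding holomorphic_several_on_def
proof
  fix z assume z: "z \<in> U"
  obtain f' where f': "(f has_derivative f') (at z)" "\<forall>c v. f' (c *s v) = c * f' v"
    using assms(1) z unfolding holomorphic_several_on_def by blast
  obtain g' where g': "(g has_derivative g') (at z)" "\<forall>c v. g' (c *s v) = c * g' v"
    using assms(2) z unfolding holomorphic_several_on_def by blast
  show "\<exists>h'. ((\<lambda>z. f z + g z) has_derivative h') (at z) \<and> (\<forall>c v. h' (c *s v) = c * h' v)"
    using has_derivative_add[OF f'(1) g'(1)] f'(2) g'(2)
    by (intro exI[of _ "\<lambda>v. f' v + g' v"]) (simp add: distrib_left)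
qed

lemma holomorphic_several_on_mult:
  assumes "holomorphic_several_on f U" "holomorphic_several_on g U"
  shows "holomorphic_several_on (\<lambda>z. f z * g z) U"
  unfolding holomorphic_several_on_def
proof
  fix z assume z: "z \<in> U"
  obtain f' where f': "(f has_derivative f') (at z)" "\<forall>c v. f' (c *s v) = c * f' v"
    using assms(1) z unfolding holomorphic_several_on_def by blast
  obtain g' where g': "(g has_derivative g') (at z)" "\<forall>c v. g' (c *s v) = c * g' v"
    using assms(2) z unfolding holomorphic_several_on_def by blast
  show "\<exists>h'. ((\<lambda>z. f z * g z) has_derivative h') (at z) \<and> (\<forall>c v. h' (c *s v) = c * h' v)"
    using has_derivative_mult[OF f'(1) g'(1)] f'(2) g'(2)
    by (intro exI[of _ "\<lambda>v. f z * g' v + f' v * g z"]) (simp add: distrib_left mult_ac)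
qed

lemma holomorphic_several_on_inverse:
  assumes "holomorphic_several_on f U" "\<And>z. z \<in> U \<Longrightarrow> f z \<noteq> 0"
  shows "holomorphic_several_on (\<lambda>z. inverse (f z)) U"
  unfolding holomorphic_several_on_def
proof
  fix z assume z: "z \<in> U"
  obtain f' where f': "(f has_derivative f') (at z)" "\<forall>c v. f' (c *s v) = c * f' v"
    using assms(1) z unfolding holomorphic_several_on_def by blast
  show "\<exists>h'. ((\<lambda>z. inverse (f z)) has_derivative h') (at z) \<and> (\<forall>c v. h' (c *s v) = c * h' v)"
    using Deriv.has_derivative_inverse[OF assms(2)[OF z] f'(1)] f'(2)
    by (intro exI[of _ "\<lambda>v. - (inverse (f z) * f' v * inverse (f z))"]) simp
qed

text \<open>Representatives are \<open>undefined\<close> outside \<open>K\<close>, but the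
  derivative at a point of the open set \<open>U\<close> depends only on nearby values, all taken
  inside \<open>K\<close>.\<close>

lemma holomorphic_several_on_restrict:
  assumes "holomorphic_several_on f U" "open U" "U \<subseteq> K"
  shows "holomorphic_several_on (restrict f K) U"
  unfolding holomorphic_several_on_def
proof
  fix z assume z: "z \<in> U"
  obtain f' where f': "(f has_derivative f') (at z)" "\<forall>c v. f' (c *s v) = c * f' v"
    using assms(1) z unfolding holomorphic_several_on_def by blast
  have "(restrict f K has_derivative f') (at z)"
    by (rule has_derivative_transform_within_open[OF f'(1) assms(2) z]) (use assms(3) in auto)
  with f'(2) show "\<exists>h'. (restrict f K has_derivative h') (at z) \<and> (\<forall>c v. h' (c *s v) = c * h' v)"
    by blast
qed

lemma carrier_polydisk_algebra:
  "f \<in> carrier polydisk_algebra \<longleftrightarrow>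
    continuous_on closed_polydisk f \<and> holomorphic_several_on f open_polydisk \<and>
    f \<in> extensional closed_polydisk"
  by (simp add: polydisk_algebra_def)

lemma algebra_polydisk_algebra:
  "algebra (ring_of_type_algebra :: complex ring) (polydisk_algebra :: (complex, complex ^ 'n \<Rightarrow> complex) module)"
  unfolding polydisk_algebra_def
  by (rule algebra_function_algebra)
    (simp_all add: continuous_on_add continuous_on_mult holomorphic_several_on_const
      holomorphic_several_on_add holomorphic_several_on_mult
      holomorphic_several_on_restrict[OF _ open_open_polydisk open_polydisk_subset])

text \<open>The difference is continuous and vanishes on a dense subset of the closed polydisk;
  elsewhere both functions are \<open>undefined\<close>.\<close>

lemma polydisk_algebra_eqI:
  fixes f g :: "complex ^ 'n \<Rightarrow> complex"
  assumes "f \<in> carrier polydisk_algebra" "g \<in> carrier polydisk_algebra"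
    and eq: "\<And>z. z \<in> open_polydisk \<Longrightarrow> f z = g z"
  shows "f = g"
proof (rule extensionalityI)
  show "f \<in> extensional closed_polydisk" "g \<in> extensional closed_polydisk"
    using assms(1,2) by (simp_all add: carrier_polydisk_algebra)
  fix z :: "complex ^ 'n" assume "z \<in> closed_polydisk"
  moreover have "continuous_on (closure open_polydisk) (\<lambda>z. f z - g z)"
    using assms(1,2) by (simp add: closure_open_polydisk carrier_polydisk_algebra continuous_on_diff)
  ultimately have "f z - g z = 0"
    using continuous_constant_on_closure[of open_polydisk "\<lambda>z. f z - g z" 0 z] eq
    by (simp add: closure_open_polydisk)
  then show "f z = g z" by simp
qed

text \<open>Two points where the factors do not vanish span a complex line, on which the
  one-variable identity theorem applies.\<close>

lemma holomorphic_several_mult_eq_0: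
  fixes f g :: "complex ^ 'n \<Rightarrow> complex"
  assumes f: "holomorphic_several_on f open_polydisk" and g: "holomorphic_several_on g open_polydisk"
    and prod: "\<And>z. z \<in> open_polydisk \<Longrightarrow> f z * g z = 0"
    and a: "a \<in> open_polydisk" "f a \<noteq> 0" and b: "b \<in> open_polydisk"
  shows "g b = 0"
proof -
  define c :: "complex \<Rightarrow> complex ^ 'n" where "c t = (\<chi> i. a $ i + t * (b $ i - a $ i))" for t
  \<comment> \<open>The slice of the polydisk by the line. As the preimage of a convex set under an
    affine map it is convex, hence connected, as the identity theorem requires.\<close>
  define U where "U = {t. c t \<in> open_polydisk}"
  have "open U"
  proof -
    have "continuous_on UNIV c"
      unfolding c_def by (intro continuous_intros)
    then have "open (c -` open_polydisk)"
      using open_vimage[OF open_open_polydisk] by blast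
    then show ?thesis by (simp add: U_def vimage_def)
  qed
  have "convex U"
  proof (rule convexI)
    fix s t and u v :: real
    assume st: "s \<in> U" "t \<in> U" and uv: "0 \<le> u" "0 \<le> v" "u + v = 1"
    \<comment> \<open>\<open>p + q\<close> stands for the coefficient 1 of \<open>a $ i\<close>,
      which turns affinity of \<open>c\<close> into a polynomial identity.\<close>
    have ring: "(p + q) * x + (p * s + q * t) * (y - x) = p * (x + s * (y - x)) + q * (x + t * (y - x))"
      for p q x y :: complex
      by (simp only: ring_distribs) simp
    have "c (u *\<^sub>R s + v *\<^sub>R t) $ i = u *\<^sub>R (c s $ i) + v *\<^sub>R (c t $ i)" for i
    proof -
      have "c (u *\<^sub>R s + v *\<^sub>R t) $ i
          = (of_real (u + v)) * (a $ i) + (of_real u * s + of_real v * t) * (b $ i - a $ i)"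
        unfolding uv(3) by (simp add: c_def scaleR_conv_of_real)
      also have "\<dots> = of_real u * (a $ i + s * (b $ i - a $ i)) + of_real v * (a $ i + t * (b $ i - a $ i))"
        unfolding of_real_add by (rule ring)
      finally show ?thesis by (simp add: c_def scaleR_conv_of_real)
    qed
    moreover have "u *\<^sub>R (c s $ i) + v *\<^sub>R (c t $ i) \<in> ball 0 1" for i
      by (rule convexD[OF convex_ball _ _ uv]) (use st in \<open>simp_all add: U_def open_polydisk_def\<close>)
    ultimately show "u *\<^sub>R s + v *\<^sub>R t \<in> U"
      by (simp add: U_def open_polydisk_def)
  qed
  then have "connected U" by (rule convex_connected)
  have c0: "c 0 = a" and c1: "c 1 = b" by (simp_all add: c_def vec_eq_iff)
  have hol: "(\<lambda>t. h (c t)) holomorphic_on U" if "holomorphic_several_on h open_polydisk" for h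
  proof (rule holomorphic_several_on_compose[OF that \<open>open U\<close>])
    show "(\<lambda>t. c t $ i) holomorphic_on U" for i
      unfolding c_def vec_lambda_beta by (intro holomorphic_intros)
  qed (auto simp: U_def)
  have U0: "0 \<in> U" and U1: "1 \<in> U" using a(1) b by (simp_all add: U_def c0 c1)
  have "continuous_on U (\<lambda>t. f (c t))"
    by (rule holomorphic_on_imp_continuous_on[OF hol[OF f]])
  \<comment> \<open>On this open set, which contains \<open>t = 0\<close>, the first factor is
    nonzero along the line, so the second one vanishes; analytic continuation carries this to
    \<open>t = 1\<close>.\<close>
  then have op: "open (U \<inter> (\<lambda>t. f (c t)) -` (- {0}))" (is "open ?V")
    by (rule continuous_open_preimage[OF _ \<open>open U\<close>]) (rule open_Compl[OF closed_singleton])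
  have "0 \<in> ?V" using U0 a(2) c0 by simp
  then have ne: "?V \<noteq> {}" by blast
  have "g (c t) = 0" if "t \<in> ?V" for t
    using prod[of "c t"] that by (simp add: U_def)
  from analytic_continuation_open[OF op \<open>open U\<close> ne \<open>connected U\<close> _ hol[OF g] holomorphic_on_const this U1]
  have "g (c 1) = 0" by blast
  then show ?thesis by (simp add: c1)
qed

section \<open>The integral domain property and the embedding\<close>

lemma polydisk_algebra_sel:
  "\<one>\<^bsub>polydisk_algebra\<^esub> = (\<lambda>z\<in>closed_polydisk. 1)"
  "\<zero>\<^bsub>polydisk_algebra\<^esub> = (\<lambda>z\<in>closed_polydisk. 0)"
  "f \<otimes>\<^bsub>polydisk_algebra\<^esub> g = (\<lambda>z\<in>closed_polydisk. f z * g z)"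
  "f \<oplus>\<^bsub>polydisk_algebra\<^esub> g = (\<lambda>z\<in>closed_polydisk. f z + g z)"
  by (simp_all add: polydisk_algebra_def)

text \<open>If one factor is nonzero somewhere in the open polydisk, the other vanishes throughout
  it and is the zero element by density.\<close>

lemma domain_polydisk_algebra: "domain (polydisk_algebra :: (complex, complex ^ 'n \<Rightarrow> complex) module)"
proof -
  have cring: "cring (polydisk_algebra :: (complex, complex ^ 'n \<Rightarrow> complex) module)"
    by (rule algebra.M_cring[OF algebra_polydisk_algebra])
  show ?thesis
  proof (intro domain.intro domain_axioms.intro cring)
    show "\<one>\<^bsub>polydisk_algebra\<^esub> \<noteq> (\<zero>\<^bsub>polydisk_algebra\<^esub> :: complex ^ 'n \<Rightarrow> complex)"
    proof
      assume "\<one>\<^bsub>polydisk_algebra\<^esub> = (\<zero>\<^bsub>polydisk_algebra\<^esub> :: complex ^ 'n \<Rightarrow> complex)"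
      from fun_cong[OF this, of 0] show False
        by (simp add: polydisk_algebra_sel closed_polydisk_def)
    qed
    fix f g :: "complex ^ 'n \<Rightarrow> complex"
    assume fg: "f \<otimes>\<^bsub>polydisk_algebra\<^esub> g = \<zero>\<^bsub>polydisk_algebra\<^esub>"
      "f \<in> carrier polydisk_algebra" "g \<in> carrier polydisk_algebra"
    have prod: "f z * g z = 0" if "z \<in> open_polydisk" for z
    proof -
      have "z \<in> closed_polydisk" using that open_polydisk_subset by blast
      with fun_cong[OF fg(1), of z] show ?thesis by (simp add: polydisk_algebra_sel)
    qed
    have zero: "h = \<zero>\<^bsub>polydisk_algebra\<^esub>"
      if "h \<in> carrier polydisk_algebra" "\<And>z. z \<in> open_polydisk \<Longrightarrow> h z = 0"
      for h :: "complex ^ 'n \<Rightarrow> complex"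
    proof (rule polydisk_algebra_eqI[OF that(1)])
      show "\<zero>\<^bsub>polydisk_algebra\<^esub> \<in> carrier (polydisk_algebra :: (complex, complex ^ 'n \<Rightarrow> complex) module)"
        using cring by (rule cring.cring_simprules(2))
      fix z :: "complex ^ 'n" assume z: "z \<in> open_polydisk"
      then have "z \<in> closed_polydisk" using open_polydisk_subset by blast
      then show "h z = \<zero>\<^bsub>polydisk_algebra\<^esub> z"
        using that(2)[OF z] by (simp add: polydisk_algebra_sel)
    qed
    show "f = \<zero>\<^bsub>polydisk_algebra\<^esub> \<or> g = \<zero>\<^bsub>polydisk_algebra\<^esub>"
    proof (cases "\<exists>a\<in>open_polydisk. f a \<noteq> 0")
      case True
      then obtain a where a: "a \<in> open_polydisk" "f a \<noteq> 0" by blast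
      have "g b = 0" if "b \<in> open_polydisk" for b
      proof (rule holomorphic_several_mult_eq_0[of f g a b])
        show "holomorphic_several_on f open_polydisk" "holomorphic_several_on g open_polydisk"
          using fg(2,3) unfolding carrier_polydisk_algebra by blast+
      qed (fact prod a that)+
      then show ?thesis using zero[OF fg(3)] by blast
    next
      case False
      then show ?thesis using zero[OF fg(2)] by blast
    qed
  qed
qed

lemma embed_S_inj:
  "inj_on embed_S (carrier (polydisk_algebra :: (complex, complex ^ 'n \<Rightarrow> complex) module))"
proof (rule inj_onI)
  fix f g :: "complex ^ 'n \<Rightarrow> complex"
  assume f: "f \<in> carrier polydisk_algebra" and g: "g \<in> carrier polydisk_algebra"
    and eq: "embed_S f = embed_S g"
  have eq': "restrict f torus = restrict g torus"
    using eq by (simp add: embed_S_def)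
  have torus: "f z = g z" if "z \<in> torus" for z
    using fun_cong[OF eq', of z] that by simp
  note f' = f[unfolded carrier_polydisk_algebra] and g' = g[unfolded carrier_polydisk_algebra]
  \<comment> \<open>The difference is written as a sum with a multiple by -1, so that closure of
    holomorphy under sums and products applies.\<close>
  have cont: "continuous_on closed_polydisk (\<lambda>z. f z + - 1 * g z)"
    by (rule continuous_on_add continuous_on_mult continuous_on_const conjunct1[OF f'] conjunct1[OF g'])+
  have hol: "holomorphic_several_on (\<lambda>z. f z + - 1 * g z) open_polydisk"
    by (rule holomorphic_several_on_add holomorphic_several_on_mult holomorphic_several_on_const
        conjunct1[OF conjunct2[OF f']] conjunct1[OF conjunct2[OF g']])+
  have max_mod: "cmod (f z + - 1 * g z) \<le> 0" if "z \<in> closed_polydisk" for z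
    by (rule polydisk_maximum_modulus[OF cont hol _ that]) (simp add: torus)
  have "f z = g z" if "z \<in> open_polydisk" for z
    using max_mod[of z] that open_polydisk_subset by auto
  then show "f = g" by (rule polydisk_algebra_eqI[OF f g])
qed

lemma continuous_on_diagonal:
  assumes "f \<in> carrier polydisk_algebra"
  shows "continuous_on (cball 0 1) (\<lambda>z. f (\<chi> i. z))"
proof (rule continuous_on_compose2[of closed_polydisk f])
  show "continuous_on closed_polydisk f"
    using assms by (simp add: carrier_polydisk_algebra)
  show "continuous_on (cball 0 1) (\<lambda>z. \<chi> i. z)"
    by (intro continuous_intros)
qed (auto simp: closed_polydisk_def)

lemma circle_subset: "circle \<subseteq> cball 0 1"
  by (auto simp: circle_def)

text \<open>The operations on the two sides truncate to different sets; they are compatible because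
  the torus and the diagonal circle lie in the closed polydisk.\<close>

lemma embed_S_hom:
  assumes R: "R \<subseteq> carrier (polydisk_algebra :: (complex, complex ^ 'n \<Rightarrow> complex) module)"
  shows "embed_S \<in> ring_hom (polydisk_algebra\<lparr>carrier := R\<rparr>) S_algebra"
proof -
  have torus: "z \<in> closed_polydisk" if "z \<in> torus" for z :: "complex ^ 'n"
    using that torus_subset by blast
  have diag: "(\<chi> i. z) \<in> (closed_polydisk :: (complex ^ 'n) set)" if "z \<in> circle" for z
    using that by (simp add: circle_def closed_polydisk_def)
  show ?thesis
  proof (rule ring_hom_memI)
    fix f assume "f \<in> carrier (polydisk_algebra\<lparr>carrier := R\<rparr>)"
    then have f: "f \<in> carrier polydisk_algebra" using R by auto
    then have "continuous_on torus f"
      using torus_subset continuous_on_subset by (auto simp: carrier_polydisk_algebra)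
    moreover have "continuous_on circle (\<lambda>z. f (\<chi> i. z))"
      by (rule continuous_on_subset[OF continuous_on_diagonal[OF f] circle_subset])
    ultimately show "embed_S f \<in> carrier S_algebra"
      by (simp add: embed_S_def S_algebra_def carrier_cont_algebra)
  qed (simp_all add: embed_S_def S_algebra_def cont_algebra_def polydisk_algebra_sel torus diag
      cong: restrict_cong)
qed

section \<open>The algebra \<open>C(T\<^sup>n) \<times> C(T)\<close> and the index\<close>

lemma torus_ne: "(torus :: (complex ^ 'n) set) \<noteq> {}"
proof -
  have "(\<chi> i. 1) \<in> (torus :: (complex ^ 'n) set)" by (simp add: torus_def)
  then show ?thesis by blast
qed

lemma circle_ne: "circle \<noteq> {}"
proof -
  have "1 \<in> circle" by (simp add: circle_def)
  then show ?thesis by blast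
qed

lemma carrier_S_algebra:
  "x \<in> carrier S_algebra \<longleftrightarrow> continuous_on torus (fst x) \<and> fst x \<in> extensional torus \<and>
    continuous_on circle (snd x) \<and> snd x \<in> extensional circle"
  by (auto simp: S_algebra_def carrier_cont_algebra mem_Times_iff)

lemma S_algebra_sel:
  "x \<otimes>\<^bsub>S_algebra\<^esub> y = (\<lambda>z\<in>torus. fst x z * fst y z, \<lambda>z\<in>circle. snd x z * snd y z)"
  "\<one>\<^bsub>S_algebra\<^esub> = (\<lambda>z\<in>torus. 1, \<lambda>z\<in>circle. 1)"
  "\<zero>\<^bsub>S_algebra\<^esub> = (\<lambda>z\<in>torus. 0, \<lambda>z\<in>circle. 0)"
  "x \<oplus>\<^bsub>S_algebra\<^esub> y = (\<lambda>z\<in>torus. fst x z + fst y z, \<lambda>z\<in>circle. snd x z + snd y z)"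
  "c \<odot>\<^bsub>S_algebra\<^esub> x = (\<lambda>z\<in>torus. c * fst x z, \<lambda>z\<in>circle. c * snd x z)"
  by (simp_all add: S_algebra_def cont_algebra_def)

lemma banach_S_algebra:
  "complex_comm_banach_algebra (S_algebra :: (complex, (complex ^ 'n \<Rightarrow> complex) \<times> _) module) S_norm"
  unfolding S_algebra_def S_norm_def
  by (intro banach_product_algebra banach_cont_algebra compact_torus compact_circle torus_ne circle_ne)

lemma algebra_S_algebra:
  "algebra (ring_of_type_algebra :: complex ring) (S_algebra :: (complex, (complex ^ 'n \<Rightarrow> complex) \<times> _) module)"
  unfolding S_algebra_def by (intro algebra_product_algebra algebra_cont_algebra)

text \<open>Point evaluations in either component are characters, and an element killed by all of
  them is 0 on both sets.\<close>

lemma semisimple_S_algebra: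
  "comm_semisimple (S_algebra :: (complex, (complex ^ 'n \<Rightarrow> complex) \<times> _) module)"
proof (rule comm_semisimple_if_characters_separate[OF algebra_S_algebra])
  let ?\<Phi> = "(\<lambda>p x. fst x p) ` torus \<union> (\<lambda>p x. snd x p) ` circle
    :: ((complex ^ 'n \<Rightarrow> complex) \<times> (complex \<Rightarrow> complex) \<Rightarrow> complex) set"
  show "?\<Phi> \<subseteq> ring_hom S_algebra (ring_of_type_algebra :: complex ring)"
  proof
    fix h assume "h \<in> ?\<Phi>"
    then show "h \<in> ring_hom S_algebra (ring_of_type_algebra :: complex ring)"
    proof (elim UnE imageE)
      fix p assume "p \<in> torus" "h = (\<lambda>x. fst x p)"
      then show ?thesis by (intro ring_hom_memI) (simp_all add: S_algebra_sel)
    next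
      fix p assume "p \<in> circle" "h = (\<lambda>x. snd x p)"
      then show ?thesis by (intro ring_hom_memI) (simp_all add: S_algebra_sel)
    qed
  qed
  show "?\<Phi> \<noteq> {}" using circle_ne by blast
  show "h (c \<odot>\<^bsub>S_algebra\<^esub> x) = c * h x" if "h \<in> ?\<Phi>" for h c x
    using that by (elim UnE imageE) (simp_all add: S_algebra_sel)
  fix x :: "(complex ^ 'n \<Rightarrow> complex) \<times> (complex \<Rightarrow> complex)"
  assume x: "x \<in> carrier S_algebra" and 0: "\<And>h. h \<in> ?\<Phi> \<Longrightarrow> h x = 0"
  have "fst x p = 0" if "p \<in> torus" for p
    using 0[of "\<lambda>x. fst x p"] that by blast
  then have "fst x = (\<lambda>z\<in>torus. 0)"
    using x by (intro extensionalityI[of _ torus]) (simp_all add: carrier_S_algebra)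
  moreover have "snd x p = 0" if "p \<in> circle" for p
    using 0[of "\<lambda>x. snd x p"] that by blast
  then have "snd x = (\<lambda>z\<in>circle. 0)"
    using x by (intro extensionalityI[of _ circle]) (simp_all add: carrier_S_algebra)
  ultimately show "x = \<zero>\<^bsub>S_algebra\<^esub>"
    by (simp add: S_algebra_sel prod_eq_iff)
qed

lemma involution_S_algebra:
  "algebra_involution (S_algebra :: (complex, (complex ^ 'n \<Rightarrow> complex) \<times> _) module) S_star"
proof -
  have S_star: "S_star x = (\<lambda>z\<in>torus. cnj (fst x z), \<lambda>z\<in>circle. cnj (snd x z))"
    for x :: "(complex ^ 'n \<Rightarrow> complex) \<times> (complex \<Rightarrow> complex)"
    by (simp add: S_star_def case_prod_unfold)
  show ?thesis
    unfolding algebra_involution_def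
  proof (intro conjI ballI allI)
    fix x :: "(complex ^ 'n \<Rightarrow> complex) \<times> (complex \<Rightarrow> complex)"
    assume x: "x \<in> carrier S_algebra"
    show "S_star x \<in> carrier S_algebra"
      using x by (simp add: carrier_S_algebra S_star continuous_on_cnj)
    show "S_star (S_star x) = x"
      using x by (simp add: carrier_S_algebra S_star extensional_restrict prod_eq_iff cong: restrict_cong)
  qed (simp_all add: S_star S_algebra_sel mult.commute cong: restrict_cong)
qed

lemma Units_S_algebraD:
  assumes "x \<in> Units S_algebra"
  shows "x \<in> carrier S_algebra" "continuous_on circle (snd x)"
    and "\<And>z. z \<in> torus \<Longrightarrow> fst x z \<noteq> 0" "\<And>z. z \<in> circle \<Longrightarrow> snd x z \<noteq> 0"
proof -
  show "x \<in> carrier S_algebra" using assms by (simp add: Units_def)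
  then show "continuous_on circle (snd x)" by (simp add: carrier_S_algebra)
  obtain y where "x \<otimes>\<^bsub>S_algebra\<^esub> y = \<one>\<^bsub>S_algebra\<^esub>"
    using assms unfolding Units_def by blast
  then have y: "(\<lambda>z\<in>torus. fst x z * fst y z) = (\<lambda>z\<in>torus. 1)"
    "(\<lambda>z\<in>circle. snd x z * snd y z) = (\<lambda>z\<in>circle. 1)"
    by (simp_all add: S_algebra_sel)
  show "fst x z \<noteq> 0" if "z \<in> torus" for z
    using fun_cong[OF y(1), of z] that by auto
  show "snd x z \<noteq> 0" if "z \<in> circle" for z
    using fun_cong[OF y(2), of z] that by auto
qed

section \<open>The index on invertible elements\<close>

lemma iota_eq: "iota x = wind (snd x)"
  by (simp add: iota_def case_prod_unfold)

lemma iota_mult: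
  assumes "a \<in> Units S_algebra" "b \<in> Units S_algebra"
  shows "iota (a \<otimes>\<^bsub>S_algebra\<^esub> b) = iota a + iota b"
proof -
  have "iota (a \<otimes>\<^bsub>S_algebra\<^esub> b) = wind (\<lambda>z. snd a z * snd b z)"
    unfolding iota_eq by (rule wind_cong) (simp add: S_algebra_sel)
  also have "\<dots> = iota a + iota b"
    unfolding iota_eq
    by (rule wind_mult) (rule Units_S_algebraD[OF assms(1)] Units_S_algebraD[OF assms(2)]; assumption)+
  finally show ?thesis .
qed

lemma iota_star:
  assumes "a \<in> Units S_algebra"
  shows "iota (S_star a) = - iota a"
proof -
  have "iota (S_star a) = wind (\<lambda>z. cnj (snd a z))"
    unfolding iota_eq by (rule wind_cong) (simp add: S_star_def case_prod_unfold)
  also have "\<dots> = - iota a"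
    unfolding iota_eq by (rule wind_cnj) (rule Units_S_algebraD[OF assms]; assumption)+
  finally show ?thesis .
qed

text \<open>The radius is the minimum modulus of the circle component, positive for a unit. Within
  it the circle components satisfy the hypothesis of \<open>wind_perturb\<close>.\<close>

lemma iota_locally_constant:
  fixes x :: "(complex ^ 'n \<Rightarrow> complex) \<times> (complex \<Rightarrow> complex)"
  assumes x: "x \<in> Units S_algebra"
  obtains r where "0 < r"
    "\<And>y. y \<in> carrier S_algebra \<Longrightarrow> norm_dist S_algebra S_norm x y < r \<Longrightarrow> iota y = iota x"
proof -
  note x' = Units_S_algebraD[OF x]
  have "continuous_on circle (\<lambda>z. cmod (snd x z))"
    by (rule continuous_on_norm[OF x'(2)])
  from continuous_attains_inf[OF compact_circle circle_ne this]
  obtain z0 where z0: "z0 \<in> circle" "\<And>z. z \<in> circle \<Longrightarrow> cmod (snd x z0) \<le> cmod (snd x z)"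
    by blast
  show ?thesis
  proof (rule that)
    show "0 < cmod (snd x z0)" using x'(4)[OF z0(1)] by simp
    fix y :: "(complex ^ 'n \<Rightarrow> complex) \<times> (complex \<Rightarrow> complex)"
    assume y: "y \<in> carrier S_algebra" and close: "norm_dist S_algebra S_norm x y < cmod (snd x z0)"
    have carr: "fst x \<in> carrier (cont_algebra torus)" "snd x \<in> carrier (cont_algebra circle)"
      "fst y \<in> carrier (cont_algebra torus)" "snd y \<in> carrier (cont_algebra circle)"
      using x'(1) y by (simp_all add: carrier_S_algebra carrier_cont_algebra)
    have "norm_dist (cont_algebra circle) (sup_norm circle) (snd x) (snd y) < cmod (snd x z0)"
      using close norm_dist_product_algebra[OF algebra_cont_algebra algebra_cont_algebra carr,
          of "sup_norm torus" "sup_norm circle"]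
      by (simp add: S_algebra_def S_norm_def)
    then have sup: "sup_norm circle (\<lambda>z\<in>circle. snd x z - snd y z) < cmod (snd x z0)"
      using carr by (simp add: norm_dist_def minus_cont_algebra)
    have cont_y: "continuous_on circle (snd y)" using y by (simp add: carrier_S_algebra)
    have "wind (snd y) = wind (snd x)"
    proof (rule wind_perturb[OF x'(2) cont_y])
      fix z assume z: "z \<in> circle"
      have "cmod ((\<lambda>z\<in>circle. snd x z - snd y z) z) \<le> sup_norm circle (\<lambda>z\<in>circle. snd x z - snd y z)"
        by (rule cmod_le_sup_norm[OF compact_circle circle_ne _ z])
          (simp add: continuous_on_diff x'(2) cont_y)
      then show "cmod (snd y z - snd x z) < cmod (snd x z)"
        using sup z0(2)[OF z] z by (simp add: norm_minus_commute)
    qed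
    then show "iota y = iota x" by (simp add: iota_eq)
  qed
qed

text \<open>With a discrete target the preimage of every set has to be open; around each of its
  points there is a ball on whose units the index is constant.\<close>

lemma continuous_iota:
  "continuous_map
     (subtopology (norm_topology S_algebra S_norm)
       (Units (S_algebra :: (complex, (complex ^ 'n \<Rightarrow> complex) \<times> _) module)))
     (discrete_topology (UNIV :: int set)) iota"
proof -
  let ?S = "S_algebra :: (complex, (complex ^ 'n \<Rightarrow> complex) \<times> _) module"
  interpret Metric_space "carrier ?S" "norm_dist ?S S_norm"
    by (rule complex_comm_normed_algebra.Metric_space_norm_dist[OF
          complex_comm_banach_algebra.normed_algebra[OF banach_S_algebra]])
  have top: "topspace (subtopology mtopology (Units ?S)) = Units ?S"
    using Units_S_algebraD(1) by (auto simp: topspace_subtopology)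
  have "openin (subtopology mtopology (Units ?S)) {x \<in> Units ?S. iota x \<in> U}" for U
  proof (subst openin_subopen, intro ballI)
    fix x assume "x \<in> {x \<in> Units ?S. iota x \<in> U}"
    then have x: "x \<in> Units ?S" "iota x \<in> U" by simp_all
    obtain r where r: "0 < r"
      "\<And>y. y \<in> carrier ?S \<Longrightarrow> norm_dist ?S S_norm x y < r \<Longrightarrow> iota y = iota x"
      by (rule iota_locally_constant[OF x(1)]) blast
    show "\<exists>T. openin (subtopology mtopology (Units ?S)) T \<and> x \<in> T \<and>
        T \<subseteq> {x \<in> Units ?S. iota x \<in> U}"
    proof (intro exI conjI)
      show "openin (subtopology mtopology (Units ?S)) (Units ?S \<inter> mball x r)"
        by (rule openin_subtopology_Int2[OF openin_mball])
      show "x \<in> Units ?S \<inter> mball x r"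
        using x(1) r(1) Units_S_algebraD(1)[OF x(1)] by simp
      show "Units ?S \<inter> mball x r \<subseteq> {x \<in> Units ?S. iota x \<in> U}"
      proof
        fix y assume "y \<in> Units ?S \<inter> mball x r"
        then have "y \<in> Units ?S" "y \<in> carrier ?S" "norm_dist ?S S_norm x y < r"
          by (simp_all only: Int_iff in_mball)
        then show "y \<in> {x \<in> Units ?S. iota x \<in> U}" using r(2)[of y] x(2) by simp
      qed
    qed
  qed
  then show ?thesis
    unfolding norm_topology_def continuous_map_def top by simp
qed

section \<open>Invertibility in the polydisk algebra and in its full subrings\<close>

lemma unit_polydisk_algebraI:
  fixes f :: "complex ^ 'n \<Rightarrow> complex"
  assumes f: "f \<in> carrier polydisk_algebra" and nz: "\<And>z. z \<in> closed_polydisk \<Longrightarrow> f z \<noteq> 0"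
  shows "f \<in> Units polydisk_algebra"
proof -
  define g where "g = (\<lambda>z\<in>closed_polydisk. inverse (f z))"
  note f' = f[unfolded carrier_polydisk_algebra]
  have "holomorphic_several_on (\<lambda>z. inverse (f z)) open_polydisk"
    by (rule holomorphic_several_on_inverse) (use f' nz open_polydisk_subset in blast)+
  then have "holomorphic_several_on g open_polydisk"
    unfolding g_def by (rule holomorphic_several_on_restrict[OF _ open_open_polydisk open_polydisk_subset])
  moreover have "continuous_on closed_polydisk g"
    using f' nz by (simp add: g_def continuous_on_inverse)
  ultimately have "g \<in> carrier polydisk_algebra"
    by (simp add: carrier_polydisk_algebra g_def)
  moreover have "f \<otimes>\<^bsub>polydisk_algebra\<^esub> g = \<one>\<^bsub>polydisk_algebra\<^esub>"
    "g \<otimes>\<^bsub>polydisk_algebra\<^esub> f = \<one>\<^bsub>polydisk_algebra\<^esub>"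
    by (simp_all add: polydisk_algebra_sel g_def nz cong: restrict_cong)
  ultimately show ?thesis using f unfolding Units_def by blast
qed

lemma iota_embed_S: "iota (embed_S f) = wind (\<lambda>z. f (\<chi> i. z))"
  unfolding iota_eq by (rule wind_cong) (simp add: embed_S_def)

lemma unit_iff_iota_eq_0:
  fixes R :: "(complex ^ 'n \<Rightarrow> complex) set"
  assumes full: "full_subring R polydisk_algebra" and f: "f \<in> R" and unit: "embed_S f \<in> Units S_algebra"
  shows "f \<in> Units (polydisk_algebra\<lparr>carrier := R\<rparr>) \<longleftrightarrow> iota (embed_S f) = 0"
proof -
  have sub: "subring R polydisk_algebra"
    and R_units: "f \<in> Units polydisk_algebra \<longrightarrow> f \<in> Units (polydisk_algebra\<lparr>carrier := R\<rparr>)"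
    using full f by (simp_all add: full_subring_def)
  have carr: "f \<in> carrier polydisk_algebra"
    by (rule subsetD[OF subringE(1)[OF sub] f])
  show ?thesis
  proof
    assume "f \<in> Units (polydisk_algebra\<lparr>carrier := R\<rparr>)"
    then obtain g where "f \<otimes>\<^bsub>polydisk_algebra\<lparr>carrier := R\<rparr>\<^esub> g = \<one>\<^bsub>polydisk_algebra\<lparr>carrier := R\<rparr>\<^esub>"
      unfolding Units_def by blast
    then have g: "(\<lambda>z\<in>closed_polydisk. f z * g z) = (\<lambda>z\<in>closed_polydisk. 1)"
      by (simp add: polydisk_algebra_sel)
    \<comment> \<open>An inverse makes \<open>f\<close> free of zeros on the whole closed polydisk,
      in particular on the diagonal disc that the circle bounds.\<close>
    have "f (\<chi> i. z) \<noteq> 0" if "z \<in> cball 0 1" for z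
    proof -
      have "(\<chi> i. z) \<in> (closed_polydisk :: (complex ^ 'n) set)"
        using that by (simp add: closed_polydisk_def)
      with fun_cong[OF g, of "\<chi> i. z"] show ?thesis by auto
    qed
    then show "iota (embed_S f) = 0"
      unfolding iota_embed_S by (rule wind_nonvanishing_disc[OF continuous_on_diagonal[OF carr]])
  next
    assume "iota (embed_S f) = 0"
    then have wind: "wind (\<lambda>z. f (\<chi> i. z)) = 0" by (simp only: iota_embed_S)
    have torus: "f z \<noteq> 0" if "z \<in> torus" for z
      using Units_S_algebraD(3)[OF unit that] that by (simp add: embed_S_def)
    note f' = carr[unfolded carrier_polydisk_algebra]
    have "f z \<noteq> 0" if "z \<in> closed_polydisk" for z
      by (rule nonvanishing_if_wind_diagonal_eq_0[OF conjunct1[OF f'] conjunct1[OF conjunct2[OF f']] torus wind that])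
    then have "f \<in> Units polydisk_algebra"
      by (rule unit_polydisk_algebraI[OF carr])
    with R_units show "f \<in> Units (polydisk_algebra\<lparr>carrier := R\<rparr>)" by blast
  qed
qed

theorem lemma5p11:
  fixes R :: "(complex ^ 'n \<Rightarrow> complex) set"
  assumes "full_subring R polydisk_algebra"
  shows
    \<comment> \<open>(A1)\<close>
    "domain (polydisk_algebra\<lparr>carrier := R\<rparr>) \<and>
     \<comment> \<open>(A2)\<close>
     (complex_comm_banach_algebra (S_algebra :: (complex, (complex ^ 'n \<Rightarrow> complex) \<times> _) module) S_norm \<and>
      comm_semisimple (S_algebra :: (complex, (complex ^ 'n \<Rightarrow> complex) \<times> _) module) \<and>
      algebra_involution (S_algebra :: (complex, (complex ^ 'n \<Rightarrow> complex) \<times> _) module) S_star \<and>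
      embed_S \<in> ring_hom (polydisk_algebra\<lparr>carrier := R\<rparr>) S_algebra \<and>
      inj_on embed_S R \<and>
      subring (embed_S ` R) S_algebra) \<and>
     \<comment> \<open>(A3)\<close>
     (\<forall>a \<in> Units (S_algebra :: (complex, (complex ^ 'n \<Rightarrow> complex) \<times> _) module). \<forall>b \<in> Units S_algebra.
        iota (a \<otimes>\<^bsub>S_algebra\<^esub> b) = iota a + iota b) \<and>
     (\<forall>a \<in> Units (S_algebra :: (complex, (complex ^ 'n \<Rightarrow> complex) \<times> _) module).
        iota (S_star a) = - iota a) \<and>
     continuous_map
       (subtopology (norm_topology S_algebra S_norm)
         (Units (S_algebra :: (complex, (complex ^ 'n \<Rightarrow> complex) \<times> _) module)))
       (discrete_topology (UNIV :: int set)) iota \<and>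
     \<comment> \<open>(A4)\<close>
     (\<forall>x\<in>R. embed_S x \<in> Units S_algebra \<longrightarrow>
        (x \<in> Units (polydisk_algebra\<lparr>carrier := R\<rparr>) \<longleftrightarrow> iota (embed_S x) = 0))"
proof -
  have sub: "subring R polydisk_algebra" using assms by (simp add: full_subring_def)
  have R: "R \<subseteq> carrier polydisk_algebra" by (rule subringE(1)[OF sub])
  have dom: "domain (polydisk_algebra\<lparr>carrier := R\<rparr>)"
    by (rule domain.subring_is_domain[OF domain_polydisk_algebra sub])
  have ring_R: "ring (polydisk_algebra\<lparr>carrier := R\<rparr>)"
    using dom by (simp add: domain_def cring_def)
  have ring_S: "ring (S_algebra :: (complex, (complex ^ 'n \<Rightarrow> complex) \<times> _) module)"
    by (rule cring.axioms(1)[OF algebra.M_cring[OF algebra_S_algebra]])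
  have "subring (embed_S ` R) S_algebra"
    using ring_hom_ring.img_is_subring[OF ring_hom_ringI2[OF ring_R ring_S embed_S_hom[OF R]]
        ring.carrier_is_subring[OF ring_R]]
    by simp
  then show ?thesis
    by (intro conjI ballI impI dom banach_S_algebra semisimple_S_algebra involution_S_algebra
        embed_S_hom[OF R] inj_on_subset[OF embed_S_inj R] iota_mult iota_star continuous_iota
        unit_iff_iota_eq_0[OF assms])
qed

end
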